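(* (Completeness for Sets.) For any set of formulas $\Gamma$ and formula $A$ of $\mathcal{L}$: if $\Gamma\vDash A$ then $\Gamma\vdash A$.
   Context: Language $\mathcal{L}$: first-order, with variables $V$ (which may occur free), individual constants, function symbols, predicate symbols, identity $=$, a one-place existence predicate $\exists!$, connectives $\neg,\rightarrow$ (others defined), quantifier $\forall$, and the binary quantifier $I$: if $A,B$ are formulas and $x$ a variable, $Ix[A,B]$ is a formula binding $x$ in $A$ and $B$. $A_t^x$ is substitution of $t$ for $x$ ($t$ free for $x$). Sequents $\Gamma\Rightarrow\Delta$ have finite sets of formulas on each side. The system $\mathbf{CPF}^I$ has axioms $A\Rightarrow A$ and the rules: Cut; weakening and contraction; $(L\neg)$: $\Gamma\Rightarrow\Delta,A$ / $\neg A,\Gamma\Rightarrow\Delta$; $(R\neg)$: $A,\Gamma\Rightarrow\Delta$ / $\Gamma\Rightarrow\Delta,\neg A$; $(L\rightarrow)$: $\Gamma\Rightarrow\Delta,A$ and $B,\Gamma\Rightarrow\Delta$ / $A\rightarrow B,\Gamma\Rightarrow\Delta$; $(R\rightarrow)$: $A,\Gamma\Rightarrow\Delta,B$ / $\Gamma\Rightarrow\Delta,A\rightarrow B$; $(L\forall)$: $A_t^x,\Gamma\Rightarrow\Delta$ / $\exists!t,\forall xA,\Gamma\Rightarrow\Delta$; $(R\forall)$: $\exists!a,\Gamma\Rightarrow\Delta,A_a^x$ / $\Gamma\Rightarrow\Delta,\forall xA$; identity: $A_{t_2}^x,\Gamma\Rightarrow\Delta$ / $t_1=t_2,A_{t_1}^x,\Gamma\Rightarrow\Delta$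 ($A$ atomic), and $t=t,\Gamma\Rightarrow\Delta$ / $\Gamma\Rightarrow\Delta$; $(RI)$: $\Gamma\Rightarrow\Delta,A_t^x$, $\Gamma\Rightarrow\Delta,B_t^x$, $A_a^x,\Gamma\Rightarrow\Delta,a=t$ / $\Gamma\Rightarrow\Delta,Ix[A,B]$; $(LI^1)$: $A_a^x,B_a^x,\Gamma\Rightarrow\Delta$ / $Ix[A,B],\Gamma\Rightarrow\Delta$; $(LI^2)$: $\Gamma\Rightarrow\Delta,A_{t_1}^x$, $\Gamma\Rightarrow\Delta,A_{t_2}^x$, $\Gamma\Rightarrow\Delta,C_{t_2}^x$ / $Ix[A,B],\Gamma\Rightarrow\Delta,C_{t_1}^x$ ($C$ atomic). In $(R\forall)$, $(RI)$, $(LI^1)$ the eigen-term $a$ must not occur in the conclusion. $\Gamma\vdash A$ means: for some finite $\Gamma_0\subseteq\Gamma$, $\Gamma_0\Rightarrow A$ is derivable in $\mathbf{CPF}^I$. A structure $\mathfrak{A}$ consists of a non-empty domain $|\mathfrak{A}|$, an inner domain $|\mathfrak{A}^\forall|\subseteq|\mathfrak{A}|$ (possibly empty), which is also the interpretation of $\exists!$, relations $P^\mathfrak{A}\subseteq|\mathfrak{A}|^n$, elements $c^\mathfrak{A}\in|\mathfrak{A}|$, operations $f^\mathfrak{A}\colon|\mathfrak{A}|^n\to|\mathfrak{A}|$. For $s\colon V\to|\mathfrak{A}|$, $\overline{s}$ is its extension to terms and $s(x|d)$ is $s$ modified to send $x$ to $d$. Satisfaction: $\vDash_\mathfrak{A}t_1=t_2[s]$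 iff $\overline{s}(t_1)=\overline{s}(t_2)$; $\vDash_\mathfrak{A}\exists!t[s]$ iff $\overline{s}(t)\in|\mathfrak{A}^\forall|$; atomic $Pt_1\dots t_n$ as usual; $\neg,\rightarrow$ classically; $\vDash_\mathfrak{A}\forall xA[s]$ iff $\vDash_\mathfrak{A}A[s(x|d)]$ for every $d\in|\mathfrak{A}^\forall|$; $\vDash_\mathfrak{A}Ix[A,B][s]$ iff there is $d\in|\mathfrak{A}|$ with $\vDash_\mathfrak{A}A[s(x|d)]$, no other $e\in|\mathfrak{A}|$ with $\vDash_\mathfrak{A}A[s(x|e)]$, and $\vDash_\mathfrak{A}B[s(x|d)]$. $\Gamma\vDash A$ means: for every structure $\mathfrak{A}$ and every $s\colon V\to|\mathfrak{A}|$ with which $\mathfrak{A}$ satisfies every member of $\Gamma$, $\mathfrak{A}$ satisfies $A$ with $s$. *)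

theory Defs
  imports Main
begin

text \<open>A language is a choice of individual constants, function symbols and predicate symbols
  (any of these sets may be empty, and they may have any cardinality), with arities. The variables
  are the natural numbers. Identity and the existence predicate are logical symbols.\<close>

record ('c, 'f, 'p) lang =
  Consts :: "'c set"
  Funs :: "'f set"
  Preds :: "'p set"
  farity :: "'f \<Rightarrow> nat"
  parity :: "'p \<Rightarrow> nat"

type_synonym var = nat

datatype ('c, 'f) tm =
    Var var
  | Const 'c
  | Fun 'f "('c, 'f) tm list"

datatype ('c, 'f, 'p) fm =
    Pred 'p "('c, 'f) tm list"
  | Eq "('c, 'f) tm" "('c, 'f) tm"
  | Exist "('c, 'f) tm"                                  \<comment> \<open>the existence predicate \<open>\<exists>!t\<close>\<close>
  | Neg "('c, 'f, 'p) fm"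
  | Imp "('c, 'f, 'p) fm" "('c, 'f, 'p) fm"
  | All var "('c, 'f, 'p) fm"
  | Iota var "('c, 'f, 'p) fm" "('c, 'f, 'p) fm"         \<comment> \<open>the binary quantifier \<open>Ix[A,B]\<close>\<close>

primrec wf_tm :: "('c, 'f, 'p) lang \<Rightarrow> ('c, 'f) tm \<Rightarrow> bool" where
  "wf_tm L (Var y) \<longleftrightarrow> True"
| "wf_tm L (Const c) \<longleftrightarrow> c \<in> Consts L"
| "wf_tm L (Fun f ts) \<longleftrightarrow> f \<in> Funs L \<and> length ts = farity L f \<and> list_all (wf_tm L) ts"

primrec wf_fm :: "('c, 'f, 'p) lang \<Rightarrow> ('c, 'f, 'p) fm \<Rightarrow> bool" where
  "wf_fm L (Pred p ts) \<longleftrightarrow> p \<in> Preds L \<and> length ts = parity L p \<and> list_all (wf_tm L) ts"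
| "wf_fm L (Eq t u) \<longleftrightarrow> wf_tm L t \<and> wf_tm L u"
| "wf_fm L (Exist t) \<longleftrightarrow> wf_tm L t"
| "wf_fm L (Neg A) \<longleftrightarrow> wf_fm L A"
| "wf_fm L (Imp A B) \<longleftrightarrow> wf_fm L A \<and> wf_fm L B"
| "wf_fm L (All x A) \<longleftrightarrow> wf_fm L A"
| "wf_fm L (Iota x A B) \<longleftrightarrow> wf_fm L A \<and> wf_fm L B"

definition formulas :: "('c, 'f, 'p) lang \<Rightarrow> ('c, 'f, 'p) fm set" where
  "formulas L = {A. wf_fm L A}"

primrec atomic :: "('c, 'f, 'p) fm \<Rightarrow> bool" where
  "atomic (Pred p ts) \<longleftrightarrow> True"
| "atomic (Eq t u) \<longleftrightarrow> True"
| "atomic (Exist t) \<longleftrightarrow> True"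
| "atomic (Neg A) \<longleftrightarrow> False"
| "atomic (Imp A B) \<longleftrightarrow> False"
| "atomic (All x A) \<longleftrightarrow> False"
| "atomic (Iota x A B) \<longleftrightarrow> False"

primrec subst_tm :: "('c, 'f) tm \<Rightarrow> var \<Rightarrow> ('c, 'f) tm \<Rightarrow> ('c, 'f) tm" where
  "subst_tm (Var y) x t = (if y = x then t else Var y)"
| "subst_tm (Const c) x t = Const c"
| "subst_tm (Fun f ts) x t = Fun f (map (\<lambda>u. subst_tm u x t) ts)"

text \<open>Replacement of the free occurrences of \<open>x\<close> without renaming of bound variables; the calculus
  below uses \<open>subst A x t\<close> only when \<open>t\<close> is free for \<open>x\<close> in \<open>A\<close>.\<close>

primrec subst :: "('c, 'f, 'p) fm \<Rightarrow> var \<Rightarrow> ('c, 'f) tm \<Rightarrow> ('c, 'f, 'p) fm" where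
  "subst (Pred p ts) x t = Pred p (map (\<lambda>u. subst_tm u x t) ts)"
| "subst (Eq u v) x t = Eq (subst_tm u x t) (subst_tm v x t)"
| "subst (Exist u) x t = Exist (subst_tm u x t)"
| "subst (Neg A) x t = Neg (subst A x t)"
| "subst (Imp A B) x t = Imp (subst A x t) (subst B x t)"
| "subst (All y A) x t = All y (if y = x then A else subst A x t)"
| "subst (Iota y A B) x t =
     Iota y (if y = x then A else subst A x t) (if y = x then B else subst B x t)"

primrec vars_tm :: "('c, 'f) tm \<Rightarrow> var set" where
  "vars_tm (Var y) = {y}"
| "vars_tm (Const c) = {}"
| "vars_tm (Fun f ts) = \<Union> (set (map vars_tm ts))"

primrec fvars :: "('c, 'f, 'p) fm \<Rightarrow> var set" where
  "fvars (Pred p ts) = \<Union> (vars_tm ` set ts)"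
| "fvars (Eq t u) = vars_tm t \<union> vars_tm u"
| "fvars (Exist t) = vars_tm t"
| "fvars (Neg A) = fvars A"
| "fvars (Imp A B) = fvars A \<union> fvars B"
| "fvars (All x A) = fvars A - {x}"
| "fvars (Iota x A B) = (fvars A \<union> fvars B) - {x}"

primrec free_for :: "('c, 'f) tm \<Rightarrow> var \<Rightarrow> ('c, 'f, 'p) fm \<Rightarrow> bool" where
  "free_for t x (Pred p ts) \<longleftrightarrow> True"
| "free_for t x (Eq u v) \<longleftrightarrow> True"
| "free_for t x (Exist u) \<longleftrightarrow> True"
| "free_for t x (Neg A) \<longleftrightarrow> free_for t x A"
| "free_for t x (Imp A B) \<longleftrightarrow> free_for t x A \<and> free_for t x B"
| "free_for t x (All y A) \<longleftrightarrow>
     x \<notin> fvars (All y A) \<or> (y \<notin> vars_tm t \<and> free_for t x A)"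
| "free_for t x (Iota y A B) \<longleftrightarrow>
     x \<notin> fvars (Iota y A B) \<or> (y \<notin> vars_tm t \<and> free_for t x A \<and> free_for t x B)"

primrec subterms :: "('c, 'f) tm \<Rightarrow> ('c, 'f) tm set" where
  "subterms (Var y) = {Var y}"
| "subterms (Const c) = {Const c}"
| "subterms (Fun f ts) = insert (Fun f ts) (\<Union> (set (map subterms ts)))"

text \<open>All terms occurring in a formula; bound variables, including those displayed at a
  quantifier, count as occurring.\<close>

primrec terms :: "('c, 'f, 'p) fm \<Rightarrow> ('c, 'f) tm set" where
  "terms (Pred p ts) = \<Union> (subterms ` set ts)"
| "terms (Eq t u) = subterms t \<union> subterms u"
| "terms (Exist t) = subterms t"
| "terms (Neg A) = terms A"
| "terms (Imp A B) = terms A \<union> terms B"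
| "terms (All x A) = insert (Var x) (terms A)"
| "terms (Iota x A B) = insert (Var x) (terms A \<union> terms B)"

definition occurs_in :: "('c, 'f) tm \<Rightarrow> ('c, 'f, 'p) fm set \<Rightarrow> bool" where
  "occurs_in a \<Gamma> \<longleftrightarrow> (\<exists>A\<in>\<Gamma>. a \<in> terms A)"

text \<open>Eigen-terms are variables or individual constants. A complex term would not be sound here.\<close>

definition eigen :: "('c, 'f, 'p) lang \<Rightarrow> ('c, 'f) tm \<Rightarrow> bool" where
  "eigen L a \<longleftrightarrow> (\<exists>y. a = Var y) \<or> (\<exists>c\<in>Consts L. a = Const c)"

text \<open>\<open>CPFI L \<Gamma> \<Delta>\<close>: the sequent \<open>\<Gamma> \<Rightarrow> \<Delta>\<close> of \<open>L\<close>-formulas is derivable. Sequents are pairs of finite sets,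
  so contraction (and exchange) has identical premise and conclusion and needs no rule. That
  derivable sequents consist of finite sets of \<open>L\<close>-formulas is lemma \<open>CPFI_wf\<close> below; the
  conditions \<open>wf_tm\<close>, \<open>wf_fm\<close> in the rules concern only material not already constrained by the
  premises.

  An eigen-term that does not occur in the conclusion is automatically free for \<open>x\<close>.

  In rule \<open>RI\<close> the eigen-term must moreover not occur in \<open>t\<close>, which appears in the premises only.
  Without this, taking \<open>t\<close> to be \<open>a\<close> itself would derive \<open>\<Rightarrow> Ix[x=x, x=x]\<close>, which fails in every
  structure with more than one element.\<close>

inductive CPFI :: "('c, 'f, 'p) lang \<Rightarrow> ('c, 'f, 'p) fm set \<Rightarrow> ('c, 'f, 'p) fm set \<Rightarrow> bool"
  for L :: "('c, 'f, 'p) lang" where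
  Ax: "wf_fm L A \<Longrightarrow> CPFI L {A} {A}"
| Cut: "CPFI L \<Gamma> (insert A \<Delta>) \<Longrightarrow> CPFI L (insert A \<Gamma>') \<Delta>' \<Longrightarrow> CPFI L (\<Gamma> \<union> \<Gamma>') (\<Delta> \<union> \<Delta>')"
| LW: "CPFI L \<Gamma> \<Delta> \<Longrightarrow> wf_fm L A \<Longrightarrow> CPFI L (insert A \<Gamma>) \<Delta>"
| RW: "CPFI L \<Gamma> \<Delta> \<Longrightarrow> wf_fm L A \<Longrightarrow> CPFI L \<Gamma> (insert A \<Delta>)"
| LNeg: "CPFI L \<Gamma> (insert A \<Delta>) \<Longrightarrow> CPFI L (insert (Neg A) \<Gamma>) \<Delta>"
| RNeg: "CPFI L (insert A \<Gamma>) \<Delta> \<Longrightarrow> CPFI L \<Gamma> (insert (Neg A) \<Delta>)"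
| LImp: "CPFI L \<Gamma> (insert A \<Delta>) \<Longrightarrow> CPFI L (insert B \<Gamma>) \<Delta> \<Longrightarrow> CPFI L (insert (Imp A B) \<Gamma>) \<Delta>"
| RImp: "CPFI L (insert A \<Gamma>) (insert B \<Delta>) \<Longrightarrow> CPFI L \<Gamma> (insert (Imp A B) \<Delta>)"
| LAll: "CPFI L (insert (subst A x t) \<Gamma>) \<Delta> \<Longrightarrow> wf_tm L t \<Longrightarrow> free_for t x A \<Longrightarrow>
    CPFI L (insert (Exist t) (insert (All x A) \<Gamma>)) \<Delta>"
| RAll: "CPFI L (insert (Exist a) \<Gamma>) (insert (subst A x a) \<Delta>) \<Longrightarrow>
    eigen L a \<Longrightarrow> \<not> occurs_in a (insert (All x A) (\<Gamma> \<union> \<Delta>)) \<Longrightarrow>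
    CPFI L \<Gamma> (insert (All x A) \<Delta>)"
| EqSubst: "CPFI L (insert (subst A x t\<^sub>2) \<Gamma>) \<Delta> \<Longrightarrow> atomic A \<Longrightarrow> wf_tm L t\<^sub>1 \<Longrightarrow> wf_tm L t\<^sub>2 \<Longrightarrow>
    CPFI L (insert (Eq t\<^sub>1 t\<^sub>2) (insert (subst A x t\<^sub>1) \<Gamma>)) \<Delta>"
| EqRefl: "CPFI L (insert (Eq t t) \<Gamma>) \<Delta> \<Longrightarrow> CPFI L \<Gamma> \<Delta>"
| RI: "CPFI L \<Gamma> (insert (subst A x t) \<Delta>) \<Longrightarrow> CPFI L \<Gamma> (insert (subst B x t) \<Delta>) \<Longrightarrow>
    CPFI L (insert (subst A x a) \<Gamma>) (insert (Eq a t) \<Delta>) \<Longrightarrow>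
    free_for t x A \<Longrightarrow> free_for t x B \<Longrightarrow>
    eigen L a \<Longrightarrow> \<not> occurs_in a (insert (Iota x A B) (\<Gamma> \<union> \<Delta>)) \<Longrightarrow> a \<notin> subterms t \<Longrightarrow>
    CPFI L \<Gamma> (insert (Iota x A B) \<Delta>)"
| LI1: "CPFI L (insert (subst A x a) (insert (subst B x a) \<Gamma>)) \<Delta> \<Longrightarrow>
    eigen L a \<Longrightarrow> \<not> occurs_in a (insert (Iota x A B) (\<Gamma> \<union> \<Delta>)) \<Longrightarrow>
    CPFI L (insert (Iota x A B) \<Gamma>) \<Delta>"
| LI2: "CPFI L \<Gamma> (insert (subst A x t\<^sub>1) \<Delta>) \<Longrightarrow> CPFI L \<Gamma> (insert (subst A x t\<^sub>2) \<Delta>) \<Longrightarrow>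
    CPFI L \<Gamma> (insert (subst C x t\<^sub>2) \<Delta>) \<Longrightarrow>
    wf_tm L t\<^sub>1 \<Longrightarrow> wf_tm L t\<^sub>2 \<Longrightarrow> wf_fm L B \<Longrightarrow>
    free_for t\<^sub>1 x A \<Longrightarrow> free_for t\<^sub>2 x A \<Longrightarrow> atomic C \<Longrightarrow>
    CPFI L (insert (Iota x A B) \<Gamma>) (insert (subst C x t\<^sub>1) \<Delta>)"

lemma wf_tm_subst_tm: "wf_tm L t \<Longrightarrow> wf_tm L (subst_tm u x t) \<longleftrightarrow> wf_tm L u"
  by (induction u) (auto simp: list_all_iff)

lemma wf_fm_subst: "wf_tm L t \<Longrightarrow> wf_fm L (subst A x t) \<longleftrightarrow> wf_fm L A"
  by (induction A) (auto simp: list_all_iff wf_tm_subst_tm)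

lemma eigen_wf_tm: "eigen L a \<Longrightarrow> wf_tm L a"
  by (auto simp: eigen_def)

lemma CPFI_wf:
  "CPFI L \<Gamma> \<Delta> \<Longrightarrow> finite \<Gamma> \<and> finite \<Delta> \<and> \<Gamma> \<subseteq> formulas L \<and> \<Delta> \<subseteq> formulas L"
  by (induction rule: CPFI.induct) (auto simp: formulas_def wf_fm_subst eigen_wf_tm)

definition provable :: "('c, 'f, 'p) lang \<Rightarrow> ('c, 'f, 'p) fm set \<Rightarrow> ('c, 'f, 'p) fm \<Rightarrow> bool" where
  "provable L \<Gamma> A \<longleftrightarrow> (\<exists>\<Gamma>\<^sub>0. finite \<Gamma>\<^sub>0 \<and> \<Gamma>\<^sub>0 \<subseteq> \<Gamma> \<and> CPFI L \<Gamma>\<^sub>0 {A})"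

record ('u, 'c, 'f, 'p) struct =
  dom :: "'u set"
  inner :: "'u set"
  predI :: "'p \<Rightarrow> 'u list set"
  constI :: "'c \<Rightarrow> 'u"
  funI :: "'f \<Rightarrow> 'u list \<Rightarrow> 'u"

definition is_struct :: "('c, 'f, 'p) lang \<Rightarrow> ('u, 'c, 'f, 'p) struct \<Rightarrow> bool" where
  "is_struct L M \<longleftrightarrow>
     dom M \<noteq> {} \<and> inner M \<subseteq> dom M \<and>
     (\<forall>p\<in>Preds L. predI M p \<subseteq> {ds. length ds = parity L p \<and> set ds \<subseteq> dom M}) \<and>
     (\<forall>c\<in>Consts L. constI M c \<in> dom M) \<and>
     (\<forall>f\<in>Funs L. \<forall>ds. length ds = farity L f \<and> set ds \<subseteq> dom M \<longrightarrow> funI M f ds \<in> dom M)"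

primrec eval_tm :: "('u, 'c, 'f, 'p) struct \<Rightarrow> (var \<Rightarrow> 'u) \<Rightarrow> ('c, 'f) tm \<Rightarrow> 'u" where
  "eval_tm M s (Var y) = s y"
| "eval_tm M s (Const c) = constI M c"
| "eval_tm M s (Fun f ts) = funI M f (map (eval_tm M s) ts)"

primrec sat :: "('u, 'c, 'f, 'p) struct \<Rightarrow> (var \<Rightarrow> 'u) \<Rightarrow> ('c, 'f, 'p) fm \<Rightarrow> bool" where
  "sat M s (Pred p ts) \<longleftrightarrow> map (eval_tm M s) ts \<in> predI M p"
| "sat M s (Eq t u) \<longleftrightarrow> eval_tm M s t = eval_tm M s u"
| "sat M s (Exist t) \<longleftrightarrow> eval_tm M s t \<in> inner M"
| "sat M s (Neg A) \<longleftrightarrow> \<not> sat M s A"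
| "sat M s (Imp A B) \<longleftrightarrow> (sat M s A \<longrightarrow> sat M s B)"
| "sat M s (All x A) \<longleftrightarrow> (\<forall>d\<in>inner M. sat M (s(x := d)) A)"
| "sat M s (Iota x A B) \<longleftrightarrow>
     (\<exists>d\<in>dom M. sat M (s(x := d)) A \<and>
        \<not> (\<exists>e\<in>dom M. e \<noteq> d \<and> sat M (s(x := e)) A) \<and> sat M (s(x := d)) B)"

text \<open>Consequence over all structures whose domain is a (non-empty) subset of the type \<open>'u\<close>.
  Quantification over types is not available in HOL, so \<open>'u\<close> is a parameter. By
  Loewenheim-Skolem, a type with at least as many elements as there are \<open>L\<close>-formulas (any infinite
  type if \<open>L\<close> is countable) gives the same relation as the class of all structures; a completeness
  theorem for all such \<open>'u\<close> therefore covers consequence over all structures.\<close>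

definition entails :: "'u itself \<Rightarrow> ('c, 'f, 'p) lang \<Rightarrow>
    ('c, 'f, 'p) fm set \<Rightarrow> ('c, 'f, 'p) fm \<Rightarrow> bool" where
  "entails (U :: 'u itself) L \<Gamma> A \<longleftrightarrow>
     (\<forall>(M :: ('u, 'c, 'f, 'p) struct) s.
        is_struct L M \<and> range s \<subseteq> dom M \<and> (\<forall>G\<in>\<Gamma>. sat M s G) \<longrightarrow> sat M s A)"

end

theory Submission
  imports Defs
begin

text \<open>Henkin's argument, in a language that may be uncountable and in which free variables of \<open>\<Gamma>\<close> may
  exhaust the supply of variables. New constants \<open>(n, A)\<close> with \<open>n\<close> a natural number and \<open>A\<close> an
  \<open>L\<close>-formula are added; there are as many formulas of the extended language as \<open>L\<close>-formulas, so each
  of them can be assigned its own witness whose level \<open>n\<close> exceeds the levels of the constants in it.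
  Since \<open>\<forall>\<close> ranges over the inner domain only while \<open>I\<close> ranges over all of it, witnesses are needed for the
  failure of a universal formula, for the truth of a description, and for the failure of uniqueness
  in a false description. A derivation in the extended language mentions finitely many new constants,
  which can be replaced by variables foreign to it; hence the extension is conservative. A prime theory
  containing the witnessing axioms then has a term model.\<close>

section \<open>Derived rules\<close>

lemma CPFI_weaken_union:
  assumes "CPFI L \<Gamma> \<Delta>" "finite F" "F \<subseteq> formulas L" "finite D" "D \<subseteq> formulas L"
  shows "CPFI L (F \<union> \<Gamma>) (D \<union> \<Delta>)"
proof -
  have "CPFI L (F \<union> \<Gamma>) \<Delta>"
    using assms(2,3) by (induction F) (auto simp: assms(1) formulas_def intro: LW)
  with assms(4,5) show ?thesis
    by (induction D) (auto simp: formulas_def intro: RW)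
qed

lemma CPFI_weaken:
  assumes "CPFI L \<Gamma> \<Delta>" "\<Gamma> \<subseteq> \<Gamma>'" "\<Delta> \<subseteq> \<Delta>'" "finite \<Gamma>'" "finite \<Delta>'" "\<Gamma>' \<subseteq> formulas L"
    "\<Delta>' \<subseteq> formulas L"
  shows "CPFI L \<Gamma>' \<Delta>'"
  using CPFI_weaken_union[OF assms(1,4,6,5,7)] assms(2,3) by (simp add: Un_absorb2)

lemma CPFI_axiom:
  assumes "A \<in> \<Gamma>" "A \<in> \<Delta>" "finite \<Gamma>" "finite \<Delta>" "\<Gamma> \<subseteq> formulas L" "\<Delta> \<subseteq> formulas L"
  shows "CPFI L \<Gamma> \<Delta>"
  by (rule CPFI_weaken[OF Ax[of L A]]) (use assms in \<open>auto simp: formulas_def\<close>)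

lemma CPFI_cut:
  assumes "CPFI L \<Gamma> (insert A \<Delta>)" "CPFI L (insert A \<Gamma>) \<Delta>"
  shows "CPFI L \<Gamma> \<Delta>"
  using Cut[OF assms] by simp

text \<open>Invertibility by Cut on the compound formula, the missing premise being derived from
  axioms by the rule for its connective. This and the four inversions that follow take Henkin axioms
  apart, which are built from implication and negation.\<close>

lemma CPFI_Imp_left1:
  assumes "CPFI L (insert (Imp A B) \<Gamma>) \<Delta>"
  shows "CPFI L \<Gamma> (insert A \<Delta>)"
proof (rule CPFI_cut)
  have wf: "finite \<Gamma>" "finite \<Delta>" "\<Gamma> \<subseteq> formulas L" "\<Delta> \<subseteq> formulas L" "wf_fm L A" "wf_fm L B"
    using CPFI_wf[OF assms] by (auto simp: formulas_def)
  have "CPFI L (insert A \<Gamma>) (insert B (insert A \<Delta>))"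
    by (rule CPFI_axiom[of A]) (use wf in \<open>auto simp: formulas_def\<close>)
  then show "CPFI L \<Gamma> (insert (Imp A B) (insert A \<Delta>))"
    by (rule RImp)
  show "CPFI L (insert (Imp A B) \<Gamma>) (insert A \<Delta>)"
    using assms wf by (rule_tac RW)
qed

lemma CPFI_Imp_left2:
  assumes "CPFI L (insert (Imp A B) \<Gamma>) \<Delta>"
  shows "CPFI L (insert B \<Gamma>) \<Delta>"
proof (rule CPFI_cut)
  have wf: "finite \<Gamma>" "finite \<Delta>" "\<Gamma> \<subseteq> formulas L" "\<Delta> \<subseteq> formulas L" "wf_fm L A" "wf_fm L B"
    using CPFI_wf[OF assms] by (auto simp: formulas_def)
  have "CPFI L (insert A (insert B \<Gamma>)) (insert B \<Delta>)"
    by (rule CPFI_axiom[of B]) (use wf in \<open>auto simp: formulas_def\<close>)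
  then show "CPFI L (insert B \<Gamma>) (insert (Imp A B) \<Delta>)"
    by (rule RImp)
  show "CPFI L (insert (Imp A B) (insert B \<Gamma>)) \<Delta>"
    using LW[OF assms wf(6)] by (simp add: insert_commute)
qed

lemma CPFI_Imp_right:
  assumes "CPFI L \<Gamma> (insert (Imp A B) \<Delta>)"
  shows "CPFI L (insert A \<Gamma>) (insert B \<Delta>)"
proof (rule CPFI_cut)
  have wf: "finite \<Gamma>" "finite \<Delta>" "\<Gamma> \<subseteq> formulas L" "\<Delta> \<subseteq> formulas L" "wf_fm L A" "wf_fm L B"
    using CPFI_wf[OF assms] by (auto simp: formulas_def)
  show "CPFI L (insert A \<Gamma>) (insert (Imp A B) (insert B \<Delta>))"
    by (rule CPFI_weaken[OF assms]) (use wf in \<open>auto simp: formulas_def\<close>)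
  show "CPFI L (insert (Imp A B) (insert A \<Gamma>)) (insert B \<Delta>)"
    by (rule LImp; rule CPFI_axiom[of A] CPFI_axiom[of B])
      (use wf in \<open>auto simp: formulas_def\<close>)
qed

lemma CPFI_Neg_left:
  assumes "CPFI L (insert (Neg A) \<Gamma>) \<Delta>"
  shows "CPFI L \<Gamma> (insert A \<Delta>)"
proof (rule CPFI_cut)
  have wf: "finite \<Gamma>" "finite \<Delta>" "\<Gamma> \<subseteq> formulas L" "\<Delta> \<subseteq> formulas L" "wf_fm L A"
    using CPFI_wf[OF assms] by (auto simp: formulas_def)
  show "CPFI L \<Gamma> (insert (Neg A) (insert A \<Delta>))"
    by (rule RNeg, rule CPFI_axiom[of A]) (use wf in \<open>auto simp: formulas_def\<close>)
  show "CPFI L (insert (Neg A) \<Gamma>) (insert A \<Delta>)"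
    using assms wf by (rule_tac RW)
qed

lemma CPFI_Neg_right:
  assumes "CPFI L \<Gamma> (insert (Neg A) \<Delta>)"
  shows "CPFI L (insert A \<Gamma>) \<Delta>"
proof (rule CPFI_cut)
  have wf: "finite \<Gamma>" "finite \<Delta>" "\<Gamma> \<subseteq> formulas L" "\<Delta> \<subseteq> formulas L" "wf_fm L A"
    using CPFI_wf[OF assms] by (auto simp: formulas_def)
  show "CPFI L (insert A \<Gamma>) (insert (Neg A) \<Delta>)"
    using assms wf by (rule_tac LW)
  show "CPFI L (insert (Neg A) (insert A \<Gamma>)) \<Delta>"
    by (rule LNeg, rule CPFI_axiom[of A]) (use wf in \<open>auto simp: formulas_def\<close>)
qed

section \<open>Prime theories\<close>

text \<open>Derivable sequents are finite by \<open>CPFI_wf\<close>, so ranging over all subsets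
  \<open>F\<close> amounts to ranging over the finite ones.\<close>

definition consistent :: "('c, 'f, 'p) lang \<Rightarrow> ('c, 'f, 'p) fm set \<Rightarrow> bool" where
  "consistent L S \<longleftrightarrow> S \<subseteq> formulas L \<and> (\<forall>F\<subseteq>S. \<not> CPFI L F {})"

text \<open>With \<open>D = {}\<close> this contains consistency, with a singleton \<open>D\<close>
  deductive closure, and with larger \<open>D\<close> the disjunction property. Every fact about
  \<open>H\<close> can then be read off one derivable sequent.\<close>

definition prime_theory :: "('c, 'f, 'p) lang \<Rightarrow> ('c, 'f, 'p) fm set \<Rightarrow> bool" where
  "prime_theory L H \<longleftrightarrow> H \<subseteq> formulas L \<and> (\<forall>F D. CPFI L F D \<longrightarrow> F \<subseteq> H \<longrightarrow> D \<inter> H \<noteq> {})"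

text \<open>Induction on the right side: by maximality, a formula \<open>d\<close> outside
  \<open>H\<close> is refuted together with a finite part of \<open>H\<close>, and Cut with that
  refutation removes \<open>d\<close> from the sequent.\<close>

lemma maximal_consistent_prime:
  assumes H: "consistent L H"
    and max: "\<And>d. d \<in> formulas L \<Longrightarrow> consistent L (insert d H) \<Longrightarrow> d \<in> H"
  shows "prime_theory L H"
proof -
  have False if "finite D" "CPFI L F D" "F \<subseteq> H" "D \<inter> H = {}" for F D
    using that
  proof (induction D arbitrary: F)
    case empty
    then show ?case using H by (auto simp: consistent_def)
  next
    case (insert d D)
    have d: "d \<in> formulas L" using CPFI_wf[OF insert.prems(1)] by auto
    then have "\<not> consistent L (insert d H)" using max insert.prems by auto
    then obtain F' where F': "F' \<subseteq> insert d H" "CPFI L F' {}"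
      using d H by (auto simp: consistent_def)
    \<comment> \<open>\<open>F'\<close> is brought into the form that Cut asks for, whether or not
      it contains \<open>d\<close>.\<close>
    have "CPFI L (insert d (F' - {d})) {}"
      by (rule CPFI_weaken[OF F'(2)]) (use d CPFI_wf[OF F'(2)] in auto)
    then have "CPFI L (F \<union> (F' - {d})) D"
      using Cut[OF insert.prems(1), of "F' - {d}" "{}"] by simp
    then show ?case
      by (rule insert.IH) (use insert.prems F' in auto)
  qed
  then show ?thesis
    using H CPFI_wf unfolding consistent_def prime_theory_def by meson
qed

text \<open>Zorn's lemma takes the place of an enumeration, since the language may be uncountable.
  The union of a chain stays consistent because the finite left side of a refutation already lies in
  one member.\<close>

lemma lindenbaum:
  assumes "consistent L S"
  obtains H where "S \<subseteq> H" "prime_theory L H"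
proof -
  let ?A = "{H. S \<subseteq> H \<and> consistent L H}"
  have "\<exists>M\<in>?A. \<forall>X\<in>?A. M \<subseteq> X \<longrightarrow> X = M"
  proof (rule subset_Zorn_nonempty)
    show "?A \<noteq> {}" using assms by auto
    fix C assume C: "C \<noteq> {}" "subset.chain ?A C"
    have sub: "C \<subseteq> ?A" using C(2) by (auto simp: subset.chain_def)
    have "\<not> CPFI L F {}" if F: "F \<subseteq> \<Union>C" for F
    proof
      assume d: "CPFI L F {}"
      then have "finite F" using CPFI_wf by blast
      then obtain c where "c \<in> C" "F \<subseteq> c"
        using finite_subset_Union_chain[OF _ F C] by blast
      with sub d show False by (auto simp: consistent_def)
    qed
    moreover have "S \<subseteq> \<Union>C"
      using sub C(1) by blast
    moreover have "\<Union>C \<subseteq> formulas L"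
      using sub unfolding consistent_def by blast
    ultimately show "\<Union>C \<in> ?A"
      by (simp add: consistent_def)
  qed
  then obtain H where "H \<in> ?A" and max: "\<forall>X\<in>?A. H \<subseteq> X \<longrightarrow> X = H"
    by (rule bexE)
  then have H: "S \<subseteq> H" "consistent L H" by simp_all
  have "prime_theory L H"
  proof (rule maximal_consistent_prime[OF H(2)])
    fix d assume "consistent L (insert d H)"
    then have "insert d H \<in> ?A" using H(1) by (simp add: subset_insertI2)
    with max have "insert d H = H" by (meson subset_insertI)
    then show "d \<in> H" by (metis insertI1)
  qed
  with H(1) that show ?thesis by blast
qed

section \<open>Constants of a formula\<close>

abbreviation fm_consts :: "('c, 'f, 'p) fm \<Rightarrow> 'c set" where
  "fm_consts A \<equiv> {c. Const c \<in> terms A}"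

lemma subterms_subst_tm_Const:
  "Const d \<in> subterms (subst_tm u x (Const c)) \<Longrightarrow> Const d \<in> subterms u \<or> d = c"
  by (induction u) (auto split: if_splits)

lemma terms_subst_Const:
  "Const d \<in> terms (subst A x (Const c)) \<Longrightarrow> Const d \<in> terms A \<or> d = c"
  by (induction A) (auto split: if_splits dest: subterms_subst_tm_Const)

lemma finite_subterms: "finite (subterms t)"
  by (induction t) auto

lemma finite_terms: "finite (terms A)"
  by (induction A) (auto simp: finite_subterms)

lemma free_for_Const [simp]: "free_for (Const c) x A"
  by (induction A) auto

section \<open>Henkin axioms\<close>

text \<open>The third clause serves \<open>RI\<close>: the existence formula only carries the witness \<open>c\<close> whose
  uniqueness is at stake. The last clause is a dummy.\<close>

fun henkin_axiom :: "('c, 'f, 'p) fm \<Rightarrow> ('c, 'f) tm \<Rightarrow> ('c, 'f, 'p) fm" where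
  "henkin_axiom (All x A) a = Imp (Imp (Exist a) (subst A x a)) (All x A)"
| "henkin_axiom (Iota x A B) a = Imp (Iota x A B) (Neg (Imp (subst A x a) (Neg (subst B x a))))"
| "henkin_axiom (Imp (Exist (Const c)) (Iota x A B)) a =
     Imp (subst A x (Const c)) (Imp (subst B x (Const c))
       (Imp (Imp (subst A x a) (Eq a (Const c))) (Iota x A B)))"
| "henkin_axiom _ a = Eq a a"

lemma wf_henkin_axiom: "wf_fm L \<phi> \<Longrightarrow> wf_tm L a \<Longrightarrow> wf_fm L (henkin_axiom \<phi> a)"
  by (cases "(\<phi>, a)" rule: henkin_axiom.cases) (auto simp: wf_fm_subst)

lemma consts_henkin_axiom:
  fixes \<phi> :: "('c, 'f, 'p) fm"
  shows "Const d \<in> terms (henkin_axiom \<phi> (Const a)) \<Longrightarrow> Const d \<in> terms \<phi> \<or> d = a"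
  by (cases "(\<phi>, Const a :: ('c, 'f) tm)" rule: henkin_axiom.cases)
    (auto dest!: terms_subst_Const)

text \<open>Inverting the axiom turns its refutation into the premises of \<open>RAll\<close>,
  \<open>LI1\<close> or \<open>RI\<close> with the witness as eigen-term, together with a sequent
  against which the conclusion of that rule is cut. The dummy axiom is dropped by
  \<open>EqRefl\<close>.\<close>

lemma henkin_axiom_eliminable:
  fixes \<phi> :: "('c, 'f, 'p) fm"
  assumes der: "CPFI L (insert (henkin_axiom \<phi> (Const a)) \<Gamma>) {}"
    and a: "a \<in> Consts L" "\<not> occurs_in (Const a) (insert \<phi> \<Gamma>)"
  shows "CPFI L \<Gamma> {}"
proof -
  let ?a = "Const a :: ('c, 'f) tm"
  have eig: "eigen L ?a" using a by (auto simp: eigen_def)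
  have occ: "a \<notin> fm_consts \<phi>" "\<And>G. G \<in> \<Gamma> \<Longrightarrow> a \<notin> fm_consts G"
    using a(2) by (auto simp: occurs_in_def)
  have refl: "CPFI L \<Gamma> {}" if "henkin_axiom \<phi> ?a = Eq ?a ?a"
    using der that EqRefl by metis
  show ?thesis
  proof (cases "(\<phi>, ?a)" rule: henkin_axiom.cases)
    case (1 x A a')
    then have *: "CPFI L (insert (Imp (Imp (Exist ?a) (subst A x ?a)) (All x A)) \<Gamma>) {}"
      using der by auto
    have "CPFI L \<Gamma> (insert (All x A) {})"
    proof (rule RAll[OF CPFI_Imp_right[OF CPFI_Imp_left1[OF *]] eig])
      show "\<not> occurs_in ?a (insert (All x A) (\<Gamma> \<union> {}))"
        using occ 1 by (auto simp: occurs_in_def)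
    qed
    then show ?thesis
      using CPFI_Imp_left2[OF *] by (rule CPFI_cut)
  next
    case (2 x A B a')
    then have *: "CPFI L (insert (Imp (Iota x A B)
        (Neg (Imp (subst A x ?a) (Neg (subst B x ?a))))) \<Gamma>) {}"
      using der by auto
    have "CPFI L (insert (Iota x A B) \<Gamma>) {}"
    proof (rule LI1[OF _ eig])
      show "CPFI L (insert (subst A x ?a) (insert (subst B x ?a) \<Gamma>)) {}"
        using CPFI_Neg_right[OF CPFI_Imp_right[OF CPFI_Neg_left[OF CPFI_Imp_left2[OF *]]]]
        by (simp add: insert_commute)
      show "\<not> occurs_in ?a (insert (Iota x A B) (\<Gamma> \<union> {}))"
        using occ 2 by (auto simp: occurs_in_def)
    qed
    with CPFI_Imp_left1[OF *] show ?thesis by (rule CPFI_cut)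
  next
    case (3 c x A B a')
    let ?C = "Imp (Imp (subst A x ?a) (Eq ?a (Const c))) (Iota x A B)"
    have *: "CPFI L (insert (Imp (subst A x (Const c)) (Imp (subst B x (Const c)) ?C)) \<Gamma>) {}"
      using der 3 by auto
    note ** = CPFI_Imp_left2[OF *]
    note *** = CPFI_Imp_left2[OF **]
    have "CPFI L \<Gamma> (insert (Iota x A B) {})"
    proof (rule RI[OF CPFI_Imp_left1[OF *] CPFI_Imp_left1[OF **]
          CPFI_Imp_right[OF CPFI_Imp_left1[OF ***]] free_for_Const free_for_Const eig])
      show "\<not> occurs_in ?a (insert (Iota x A B) (\<Gamma> \<union> {}))"
        using occ 3 by (auto simp: occurs_in_def)
      \<comment> \<open>The existence formula makes \<open>c\<close> occur in \<open>\<phi>\<close>,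
        so freshness of \<open>a\<close> for \<open>\<phi>\<close> rules out
        \<open>a = c\<close>.\<close>
      show "?a \<notin> subterms (Const c)"
        using occ 3 by auto
    qed
    then show ?thesis
      using CPFI_Imp_left2[OF ***] by (rule CPFI_cut)
  qed (use refl in auto)
qed

text \<open>The axioms are removed in order of decreasing level, so that the witness of the axiom being
  removed occurs in none of the remaining ones.\<close>

lemma henkin_axioms_consistent:
  fixes w :: "('c, 'f, 'p) fm \<Rightarrow> 'c"
  assumes S: "consistent L S"
    and w: "\<And>\<phi>. \<phi> \<in> formulas L \<Longrightarrow> w \<phi> \<in> Consts L" "inj_on w (formulas L)"
    and fresh: "\<And>\<phi> G. \<phi> \<in> formulas L \<Longrightarrow> G \<in> S \<Longrightarrow> w \<phi> \<notin> fm_consts G"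
    and level: "\<And>\<phi> \<psi>. \<phi> \<in> formulas L \<Longrightarrow> \<psi> \<in> formulas L \<Longrightarrow> lev \<psi> \<le> (lev \<phi> :: nat) \<Longrightarrow>
      w \<phi> \<notin> fm_consts \<psi>"
  shows "consistent L (S \<union> (\<lambda>\<phi>. henkin_axiom \<phi> (Const (w \<phi>))) ` formulas L)"
proof -
  let ?h = "\<lambda>\<phi>. henkin_axiom \<phi> (Const (w \<phi>))"
  have step: "\<forall>F\<subseteq>S. \<not> CPFI L (F \<union> ?h ` I) {}" if "finite I" "I \<subseteq> formulas L" for I
    using that
  \<comment> \<open>The inserted \<open>\<phi>\<close> has a level at least as high as all members
    of \<open>I\<close>. The rule allows \<open>\<phi>\<close> to be in \<open>I\<close> already,
    hence the case distinction.\<close>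
  proof (induction I rule: finite_ranking_induct[where f = lev])
    case empty
    then show ?case using S by (auto simp: consistent_def)
  next
    case (insert \<phi> I)
    have IH: "\<And>F. F \<subseteq> S \<Longrightarrow> \<not> CPFI L (F \<union> ?h ` I) {}" using insert by auto
    have \<phi>: "\<phi> \<in> formulas L" and I: "I \<subseteq> formulas L" using insert by auto
    show ?case
    proof (cases "\<phi> \<in> I")
      case True
      then show ?thesis using IH by (simp add: insert_absorb)
    next
      case False
      have "\<not> CPFI L (insert (?h \<phi>) (F \<union> ?h ` I)) {}" if F: "F \<subseteq> S" for F
      proof
        assume der: "CPFI L (insert (?h \<phi>) (F \<union> ?h ` I)) {}"
        \<comment> \<open>The constants of \<open>?h \<psi>\<close> come from \<open>\<psi>\<close>,
          whose level is too low for \<open>w \<phi>\<close>, or from its own witness, which differs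
          from \<open>w \<phi>\<close> by injectivity.\<close>
        have fr: "w \<phi> \<notin> fm_consts \<psi>" if "\<psi> \<in> insert \<phi> (F \<union> ?h ` I)" for \<psi>
        proof -
          have "w \<phi> \<notin> fm_consts (?h \<psi>)" if "\<psi> \<in> I" for \<psi>
          proof
            have \<psi>: "\<psi> \<in> formulas L" using that I by auto
            assume "w \<phi> \<in> fm_consts (?h \<psi>)"
            then have "w \<phi> \<in> fm_consts \<psi> \<or> w \<phi> = w \<psi>"
              by (auto dest: consts_henkin_axiom)
            moreover have "w \<phi> \<noteq> w \<psi>"
              using w(2) \<phi> \<psi> False that by (auto dest: inj_onD)
            moreover have "w \<phi> \<notin> fm_consts \<psi>"
              by (rule level[OF \<phi> \<psi>]) (use insert that in auto)
            ultimately show False by blast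
          qed
          then show ?thesis using that fresh[OF \<phi>] F level[OF \<phi> \<phi>] by auto
        qed
        have "\<not> occurs_in (Const (w \<phi>)) (insert \<phi> (F \<union> ?h ` I))"
          unfolding occurs_in_def using fr by blast
        then have "CPFI L (F \<union> ?h ` I) {}"
          by (rule henkin_axiom_eliminable[OF der w(1)[OF \<phi>]])
        with IH[OF F] show False by (rule notE)
      qed
      then show ?thesis by (simp del: not_all)
    qed
  qed
  have "\<not> CPFI L F {}" if F: "F \<subseteq> S \<union> ?h ` formulas L" for F
  proof
    assume d: "CPFI L F {}"
    then have "finite (F - S)" using CPFI_wf by blast
    moreover have "F - S \<subseteq> ?h ` formulas L" using F by auto
    ultimately have "\<exists>I\<subseteq>formulas L. finite I \<and> F - S = ?h ` I"
      by (rule finite_subset_image)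
    then obtain I where I: "I \<subseteq> formulas L" "finite I" "F - S = ?h ` I"
      by (elim exE conjE)
    have "\<not> CPFI L (F \<inter> S \<union> ?h ` I) {}"
      using step[OF I(2,1)] by simp
    moreover have "F \<inter> S \<union> ?h ` I = F"
      unfolding I(3)[symmetric] by blast
    ultimately show False using d by simp
  qed
  moreover have "?h ` formulas L \<subseteq> formulas L"
    using w(1) by (auto simp: formulas_def intro!: wf_henkin_axiom)
  ultimately show ?thesis using S by (auto simp: consistent_def)
qed

section \<open>The term model\<close>

lemma subst_tm_fresh [simp]: "x \<notin> vars_tm u \<Longrightarrow> subst_tm u x t = u"
  by (induction u) (auto intro: map_idI)

lemma finite_vars_tm: "finite (vars_tm t)"
  by (induction t) auto

lemma fresh_var: "finite V \<Longrightarrow> \<exists>y :: var. y \<notin> V"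
  by (simp add: ex_new_if_finite)

lemma Var_subterms: "Var y \<in> subterms t \<longleftrightarrow> y \<in> vars_tm t"
  by (induction t) auto

text \<open>The map \<open>code\<close> carries terms into the prescribed universe
  \<open>'u\<close>, where the domain of the model has to lie.\<close>

locale henkin_theory =
  fixes L :: "('c, 'f, 'p) lang" and H :: "('c, 'f, 'p) fm set" and code :: "('c, 'f) tm \<Rightarrow> 'u"
  assumes prime: "prime_theory L H"
    and code_inj: "inj_on code {t. wf_tm L t}"
    and witness: "wf_fm L \<phi> \<Longrightarrow> \<exists>c\<in>Consts L. henkin_axiom \<phi> (Const c) \<in> H"
begin

lemma derivable: "CPFI L F D \<Longrightarrow> F \<subseteq> H \<Longrightarrow> \<exists>d\<in>D. d \<in> H"
  using prime unfolding prime_theory_def by blast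

lemma in_H_wf: "A \<in> H \<Longrightarrow> wf_fm L A"
  using prime unfolding prime_theory_def formulas_def by auto

lemma Neg_iff: "wf_fm L A \<Longrightarrow> Neg A \<in> H \<longleftrightarrow> A \<notin> H"
  using derivable[OF RNeg[of L A "{}" "{A}"]] derivable[OF LNeg[of L "{A}" A "{}"]] Ax[of L A]
  by auto

lemma Imp_iff:
  assumes "wf_fm L A" "wf_fm L B"
  shows "Imp A B \<in> H \<longleftrightarrow> (A \<in> H \<longrightarrow> B \<in> H)"
proof -
  have ax: "CPFI L \<Gamma> \<Delta>" if "C \<in> \<Gamma> \<inter> \<Delta>" "\<Gamma> \<subseteq> {A, B}" "\<Delta> \<subseteq> {A, B}" for C \<Gamma> \<Delta>
    by (rule CPFI_axiom[of C])
      (use that assms in \<open>auto simp: formulas_def dest: finite_subset\<close>)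
  have "CPFI L {Imp A B, A} {B}"
    using LImp[of L "{A}" A "{B}" B] ax[of A "{A}" "{A, B}"] ax[of B "{B, A}" "{B}"] by simp
  moreover have "CPFI L {} {Imp A B, A}"
    using RImp[of L A "{}" B "{A}"] ax[of A "{A}" "{B, A}"] by simp
  moreover have "CPFI L {B} {Imp A B}"
    using RImp[of L A "{B}" B "{}"] ax[of B "{A, B}" "{B}"] by simp
  ultimately show ?thesis
    using derivable by blast
qed

section \<open>Identity in the theory is a congruence\<close>

lemma Eq_refl: "wf_tm L t \<Longrightarrow> Eq t t \<in> H"
  using derivable[OF EqRefl[of L t "{}" "{Eq t t}"]] Ax[of L "Eq t t"] by auto

lemma Eq_replace:
  assumes "Eq t u \<in> H" "atomic C" "subst C x t \<in> H"
  shows "subst C x u \<in> H"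
proof -
  have wf: "wf_tm L t" "wf_tm L u" using in_H_wf[OF assms(1)] by auto
  have "wf_fm L (subst C x u)"
    using in_H_wf[OF assms(3)] wf by (simp add: wf_fm_subst)
  then have "CPFI L {Eq t u, subst C x t} {subst C x u}"
    by (intro EqSubst Ax assms wf)
  then show ?thesis using derivable assms by blast
qed

text \<open>Replacement in \<open>x = t\<close>, where \<open>x\<close> does not occur in
  \<open>t\<close>, turns \<open>t = t\<close> into \<open>u = t\<close>. The fresh variable marks
  the one occurrence to be replaced; the further identity lemmas use the same device.\<close>

lemma Eq_sym: "Eq t u \<in> H \<Longrightarrow> Eq u t \<in> H"
proof -
  assume eq: "Eq t u \<in> H"
  obtain x where x: "x \<notin> vars_tm t" using fresh_var[OF finite_vars_tm] by blast
  have "wf_tm L t" using in_H_wf[OF eq] by simp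
  then have "Eq t t \<in> H" by (rule Eq_refl)
  then show ?thesis
    using Eq_replace[OF eq, of "Eq (Var x) t" x] x by simp
qed

lemma Eq_trans: "Eq t u \<in> H \<Longrightarrow> Eq u v \<in> H \<Longrightarrow> Eq t v \<in> H"
proof -
  assume eq: "Eq t u \<in> H" "Eq u v \<in> H"
  obtain x where "x \<notin> vars_tm t" using fresh_var[OF finite_vars_tm] by blast
  then show ?thesis
    using Eq_replace[OF eq(2), of "Eq t (Var x)" x] eq(1) by simp
qed

lemma Exist_cong: "Eq t u \<in> H \<Longrightarrow> Exist t \<in> H \<Longrightarrow> Exist u \<in> H"
  using Eq_replace[of t u "Exist (Var 0)" 0] by simp

text \<open>Arguments are exchanged one at a time from the left, since the identity rule replaces a
  single term by a single term; \<open>pre\<close> collects the positions already dealt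
  with.\<close>

lemma list_replace:
  assumes "list_all2 (\<lambda>t u. Eq t u \<in> H) ts us" "Q (pre @ ts)"
    and "\<And>pre t u post. Eq t u \<in> H \<Longrightarrow> Q (pre @ t # post) \<Longrightarrow> Q (pre @ u # post)"
  shows "Q (pre @ us)"
  using assms(1,2)
proof (induction arbitrary: pre rule: list_all2_induct)
  case (Cons t ts u us)
  have "Q ((pre @ [u]) @ ts)" using assms(3) Cons by simp
  then have "Q ((pre @ [u]) @ us)" by (rule Cons.IH)
  then show ?case by simp
qed simp

lemma Pred_cong:
  assumes "list_all2 (\<lambda>t u. Eq t u \<in> H) ts us" "Pred P ts \<in> H"
  shows "Pred P us \<in> H"
proof -
  have "Pred P ([] @ us) \<in> H"
  proof (rule list_replace[where Q = "\<lambda>ts. Pred P ts \<in> H", OF assms(1)])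
    fix pre post t u assume *: "Eq t u \<in> H" "Pred P (pre @ t # post) \<in> H"
    obtain x where x: "x \<notin> \<Union> (vars_tm ` set (pre @ post))"
      using fresh_var[of "\<Union> (vars_tm ` set (pre @ post))"] by (auto simp: finite_vars_tm)
    then have "map (\<lambda>u. subst_tm u x v) (pre @ Var x # post) = pre @ v # post" for v
      by (auto intro: map_idI)
    then show "Pred P (pre @ u # post) \<in> H"
      using Eq_replace[OF *(1), of "Pred P (pre @ Var x # post)" x] *(2) by simp
  qed (use assms(2) in simp)
  then show ?thesis by simp
qed

lemma Fun_cong:
  assumes "list_all2 (\<lambda>t u. Eq t u \<in> H) ts us" "wf_tm L (Fun f ts)"
  shows "Eq (Fun f ts) (Fun f us) \<in> H"
proof -
  have "Eq (Fun f ts) (Fun f ([] @ us)) \<in> H"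
  proof (rule list_replace[where Q = "\<lambda>us. Eq (Fun f ts) (Fun f us) \<in> H", OF assms(1)])
    fix pre post t u assume *: "Eq t u \<in> H" "Eq (Fun f ts) (Fun f (pre @ t # post)) \<in> H"
    \<comment> \<open>Avoiding \<open>Fun f ts\<close> as well keeps the left side of the equation
      fixed under the replacement.\<close>
    obtain x where x: "x \<notin> \<Union> (vars_tm ` set (pre @ post)) \<union> vars_tm (Fun f ts)"
      using fresh_var[of "\<Union> (vars_tm ` set (pre @ post)) \<union> vars_tm (Fun f ts)"]
      by (auto simp: finite_vars_tm)
    then have "map (\<lambda>u. subst_tm u x v) (pre @ Var x # post) = pre @ v # post" for v
      by (auto intro: map_idI)
    moreover have "subst_tm (Fun f ts) x v = Fun f ts" for v
      using x by (intro subst_tm_fresh) auto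
    ultimately show "Eq (Fun f ts) (Fun f (pre @ u # post)) \<in> H"
      using Eq_replace[OF *(1), of "Eq (Fun f ts) (Fun f (pre @ Var x # post))" x] *(2)
      by (simp del: map_append)
  qed (use Eq_refl[OF assms(2)] in simp)
  then show ?thesis by simp
qed

section \<open>Witnesses for quantifiers and descriptions\<close>

lemma All_witness:
  assumes "wf_fm L (All x A)" "All x A \<notin> H"
  obtains c where "c \<in> Consts L" "Exist (Const c) \<in> H" "subst A x (Const c) \<notin> H"
proof -
  obtain c where c: "c \<in> Consts L" "henkin_axiom (All x A) (Const c) \<in> H"
    using witness[OF assms(1)] by blast
  with assms show ?thesis
    by (intro that[of c]) (auto simp: Imp_iff wf_fm_subst)
qed

lemma Iota_witness:
  assumes "Iota x A B \<in> H"
  obtains c where "c \<in> Consts L" "subst A x (Const c) \<in> H" "subst B x (Const c) \<in> H"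
proof -
  have wf: "wf_fm L (Iota x A B)" using in_H_wf[OF assms] .
  obtain c where c: "c \<in> Consts L" "henkin_axiom (Iota x A B) (Const c) \<in> H"
    using witness[OF wf] by blast
  with assms wf show ?thesis
    by (intro that[of c]) (auto simp: Imp_iff Neg_iff wf_fm_subst)
qed

text \<open>The Henkin axiom of the third kind singles out one \<open>d\<close> such that uniqueness
  tested at \<open>d\<close> alone already yields the description.\<close>

lemma Iota_intro:
  assumes wf: "wf_fm L (Iota x A B)" and c: "c \<in> Consts L" "subst A x (Const c) \<in> H"
    "subst B x (Const c) \<in> H"
    and uniq: "\<And>d. d \<in> Consts L \<Longrightarrow> subst A x (Const d) \<in> H \<Longrightarrow> Eq (Const d) (Const c) \<in> H"
  shows "Iota x A B \<in> H"
proof -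
  obtain d where d: "d \<in> Consts L"
    "henkin_axiom (Imp (Exist (Const c)) (Iota x A B)) (Const d) \<in> H"
    using witness[of "Imp (Exist (Const c)) (Iota x A B)"] wf c(1) by auto
  then show ?thesis
    using wf c uniq[OF d(1)] by (auto simp: Imp_iff wf_fm_subst)
qed

text \<open>Rule \<open>LI2\<close> with \<open>x = d\<close> for \<open>C\<close> leads from
  \<open>d = d\<close> to \<open>c = d\<close>.\<close>

lemma Iota_unique:
  assumes "Iota x A B \<in> H" "c \<in> Consts L" "d \<in> Consts L" "subst A x (Const c) \<in> H"
    "subst A x (Const d) \<in> H"
  shows "Eq (Const c) (Const d) \<in> H"
proof -
  let ?\<Gamma> = "{subst A x (Const c), subst A x (Const d), Eq (Const d) (Const d)}"
  let ?C = "Eq (Var x) (Const d)"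
  have wf: "wf_fm L A" "wf_fm L B" "wf_tm L (Const c)" "wf_tm L (Const d)"
    using in_H_wf[OF assms(1)] assms(2,3) by auto
  have ax: "CPFI L ?\<Gamma> {G}" if "G \<in> ?\<Gamma>" for G
    by (rule CPFI_axiom[of G]) (use that wf in \<open>auto simp: formulas_def wf_fm_subst\<close>)
  have "CPFI L (insert (Iota x A B) ?\<Gamma>) (insert (subst ?C x (Const c)) {})"
    by (rule LI2[of L ?\<Gamma> A x "Const c" "{}" "Const d"]) (use ax wf in auto)
  then show ?thesis
    using derivable[of "insert (Iota x A B) ?\<Gamma>"] assms Eq_refl[OF wf(4)] by force
qed

text \<open>The description \<open>Iz[z = t, z = t]\<close> is provable, and its witness is a constant equal to \<open>t\<close>.
  All elements of the model are thus named by closed terms, which can be substituted without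
  capture.\<close>

lemma eq_Const:
  assumes "wf_tm L t"
  obtains c where "c \<in> Consts L" "Eq t (Const c) \<in> H"
proof -
  obtain z where z: "z \<notin> vars_tm t" using fresh_var[OF finite_vars_tm] by blast
  obtain y where y: "y \<notin> insert z (vars_tm t)"
    using fresh_var[of "insert z (vars_tm t)"] by (auto simp: finite_vars_tm)
  let ?A = "Eq (Var z) t"
  have sub: "subst ?A z u = Eq u t" for u using z by simp
  have refl: "CPFI L {} {Eq t t}"
    by (rule EqRefl[of L t], rule Ax) (use assms in simp)
  \<comment> \<open>In \<open>RI\<close> the instance is \<open>t\<close> and the eigenvariable
    \<open>y\<close>: the premises are \<open>t = t\<close>, twice, and the axiom with
    \<open>y = t\<close> on both sides.\<close>
  have "CPFI L {} (insert (Iota z ?A ?A) {})"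
  proof (rule RI[of L "{}" ?A z t "{}" ?A "Var y"])
    show "CPFI L (insert (subst ?A z (Var y)) {}) (insert (Eq (Var y) t) {})"
      unfolding sub using assms by (intro Ax) simp
    show "\<not> occurs_in (Var y) (insert (Iota z ?A ?A) ({} \<union> {}))"
      using y by (auto simp: occurs_in_def Var_subterms)
  qed (use refl sub y in \<open>auto simp: eigen_def Var_subterms\<close>)
  then have "Iota z ?A ?A \<in> H"
    using derivable by blast
  then obtain c where "c \<in> Consts L" "subst ?A z (Const c) \<in> H"
    by (rule Iota_witness)
  then show ?thesis
    using that Eq_sym unfolding sub by blast
qed

section \<open>Construction of the term model\<close>

definition rep :: "('c, 'f) tm \<Rightarrow> ('c, 'f) tm" where
  "rep t = (SOME u. Eq t u \<in> H)"

definition val :: "('c, 'f) tm \<Rightarrow> 'u" where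
  "val t = code (rep t)"

lemma Eq_rep: "wf_tm L t \<Longrightarrow> Eq t (rep t) \<in> H"
  unfolding rep_def by (rule someI_ex) (use Eq_refl in blast)

text \<open>Equal terms satisfy the same choice predicate, so \<open>rep\<close> depends on the
  identity class alone. Choosing representatives instead of forming classes makes each element the
  code of a single term, which fits the domain into \<open>'u\<close>.\<close>

lemma val_eq_iff:
  assumes "wf_tm L t" "wf_tm L u"
  shows "val t = val u \<longleftrightarrow> Eq t u \<in> H"
proof
  assume "val t = val u"
  moreover have "wf_tm L (rep t)" "wf_tm L (rep u)"
    using in_H_wf[OF Eq_rep] assms by auto
  ultimately have "rep t = rep u"
    unfolding val_def using code_inj by (auto dest: inj_onD)
  then show "Eq t u \<in> H"
    using Eq_rep[OF assms(1)] Eq_rep[OF assms(2)] Eq_sym Eq_trans by metis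
next
  assume "Eq t u \<in> H"
  then have "Eq t v \<in> H \<longleftrightarrow> Eq u v \<in> H" for v
    using Eq_sym Eq_trans by blast
  then show "val t = val u"
    by (simp add: val_def rep_def)
qed

lemma map_val_eq_iff:
  assumes "list_all (wf_tm L) ts" "list_all (wf_tm L) us"
  shows "map val ts = map val us \<longleftrightarrow> list_all2 (\<lambda>t u. Eq t u \<in> H) ts us"
  using assms
  by (auto simp: list_all2_conv_all_nth list_eq_iff_nth_eq list_all_length val_eq_iff)

definition unval :: "'u \<Rightarrow> ('c, 'f) tm" where
  "unval d = (SOME t. wf_tm L t \<and> val t = d)"

lemma unval: "wf_tm L t \<Longrightarrow> wf_tm L (unval (val t)) \<and> val (unval (val t)) = val t"
  unfolding unval_def by (rule someI_ex) blast

text \<open>Functions act on the names that \<open>unval\<close> picks for their arguments; by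
  \<open>Fun_cong\<close> the value does not depend on the pick. Open terms belong to the domain
  too, so that a variable can denote its own class.\<close>

definition model :: "('u, 'c, 'f, 'p) struct" where
  "model = \<lparr>dom = val ` {t. wf_tm L t}, inner = val ` {t. Exist t \<in> H},
     predI = (\<lambda>P. {map val ts |ts. Pred P ts \<in> H}), constI = (\<lambda>c. val (Const c)),
     funI = (\<lambda>f ds. val (Fun f (map unval ds)))\<rparr>"

lemma model_simps [simp]:
  "dom model = val ` {t. wf_tm L t}" "inner model = val ` {t. Exist t \<in> H}"
  "predI model P = {map val ts |ts. Pred P ts \<in> H}" "constI model c = val (Const c)"
  "funI model f ds = val (Fun f (map unval ds))"
  by (simp_all add: model_def)

lemma model_is_struct: "is_struct L model"
  unfolding is_struct_def model_simps
proof (intro conjI ballI allI impI)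
  show "val ` {t. wf_tm L t} \<noteq> {}"
    using wf_tm.simps(1)[of L 0] by blast
  show "val ` {t. Exist t \<in> H} \<subseteq> val ` {t. wf_tm L t}"
    using in_H_wf by (intro image_mono) force
  show "{map val ts |ts. Pred P ts \<in> H} \<subseteq>
      {ds. length ds = parity L P \<and> set ds \<subseteq> val ` {t. wf_tm L t}}" for P
    using in_H_wf by (force simp: list_all_iff)
  show "val (Const c) \<in> val ` {t. wf_tm L t}" if "c \<in> Consts L" for c
    using that by simp
  show "val (Fun f (map unval ds)) \<in> val ` {t. wf_tm L t}"
    if "f \<in> Funs L" "length ds = farity L f \<and> set ds \<subseteq> val ` {t. wf_tm L t}" for f ds
    using that unval by (intro imageI) (auto simp: list_all_iff)
qed

section \<open>Evaluation and truth in the term model\<close>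

abbreviation "assign \<equiv> \<lambda>y. val (Var y)"

lemma eval_model: "wf_tm L t \<Longrightarrow> eval_tm model assign t = val t"
proof (induction t)
  case (Fun f ts)
  have wf: "list_all (wf_tm L) ts" using Fun.prems by simp
  let ?us = "map (\<lambda>t. unval (val t)) ts"
  have us: "list_all (wf_tm L) ?us" "map val ts = map val ?us"
    using wf unval by (auto simp: list_all_iff)
  have eval: "map (eval_tm model assign) ts = map val ts"
    using Fun.IH wf by (auto simp: list_all_iff)
  have "eval_tm model assign (Fun f ts) = val (Fun f ?us)"
    by (simp only: eval_tm.simps model_simps eval map_map o_def)
  also have "\<dots> = val (Fun f ts)"
    using val_eq_iff[of "Fun f ts" "Fun f ?us"] Fun_cong[of ts ?us f] Fun.prems us
      map_val_eq_iff[OF wf us(1)] by simp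
  finally show ?case .
qed auto

lemma eval_subst_tm:
  "eval_tm model s (subst_tm u x (Const c)) = eval_tm model (s(x := val (Const c))) u"
proof (induction u)
  case (Fun f ts)
  then show ?case
    by (auto simp: o_def cong: map_cong)
qed auto

text \<open>A constant cannot be captured, so the substitution lemma holds for every
  \<open>A\<close>; hence the interest in naming all elements by constants.\<close>

lemma sat_subst:
  "sat model s (subst A x (Const c)) \<longleftrightarrow> sat model (s(x := val (Const c))) A"
  by (induction A arbitrary: s) (auto simp: eval_subst_tm o_def fun_upd_twist simp del: model_simps)

end

text \<open>An induction measure unchanged by substitution: the quantifier cases of the truth lemma
  pass to instances, which are not subformulas.\<close>

primrec depth :: "('c, 'f, 'p) fm \<Rightarrow> nat" where
  "depth (Pred p ts) = 0"
| "depth (Eq t u) = 0"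
| "depth (Exist t) = 0"
| "depth (Neg A) = Suc (depth A)"
| "depth (Imp A B) = Suc (depth A + depth B)"
| "depth (All x A) = Suc (depth A)"
| "depth (Iota x A B) = Suc (depth A + depth B)"

lemma depth_subst [simp]: "depth (subst A x t) = depth A"
  by (induction A) auto

context henkin_theory
begin

lemma val_Const:
  assumes "wf_tm L t"
  obtains c where "c \<in> Consts L" "val t = val (Const c)"
  using eq_Const[OF assms] assms val_eq_iff by (metis wf_tm.simps(2))

text \<open>Since constants name every element, the clauses for \<open>All\<close> and
  \<open>Iota\<close> reduce to constant instances. The witness lemmas settle a false universal
  formula and a true description, \<open>LAll\<close> and \<open>Iota_unique\<close> their
  consequences, and \<open>Iota_intro\<close> the way back to a description.\<close>

lemma truth: "wf_fm L A \<Longrightarrow> sat model assign A \<longleftrightarrow> A \<in> H"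
proof (induction "depth A" arbitrary: A rule: less_induct)
  case less
  show ?case
  proof (cases A)
    case (Pred P ts)
    then have wf: "list_all (wf_tm L) ts" using less.prems by simp
    have eval: "map (eval_tm model assign) ts = map val ts"
      using wf by (simp add: eval_model list_all_iff)
    have "sat model assign A \<longleftrightarrow> (\<exists>us. map val us = map val ts \<and> Pred P us \<in> H)"
      unfolding Pred sat.simps eval model_simps mem_Collect_eq by metis
    also have "\<dots> \<longleftrightarrow> Pred P ts \<in> H"
    proof
      assume "\<exists>us. map val us = map val ts \<and> Pred P us \<in> H"
      then obtain us where us: "map val us = map val ts" "Pred P us \<in> H" by blast
      moreover have "list_all (wf_tm L) us" using in_H_wf[OF us(2)] by simp
      ultimately show "Pred P ts \<in> H"
        using map_val_eq_iff[OF _ wf] Pred_cong by blast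
    qed blast
    finally show ?thesis using Pred by simp
  next
    case (Eq t u)
    then show ?thesis using less.prems by (simp add: eval_model val_eq_iff)
  next
    case (Exist t)
    then have wf: "wf_tm L t" using less.prems by simp
    have "val t \<in> val ` {t. Exist t \<in> H} \<longleftrightarrow> Exist t \<in> H"
    proof
      assume "val t \<in> val ` {t. Exist t \<in> H}"
      then obtain u where u: "Exist u \<in> H" "val u = val t" by auto
      with in_H_wf[OF u(1)] wf have "Eq u t \<in> H" by (simp add: val_eq_iff)
      then show "Exist t \<in> H" using u(1) by (rule Exist_cong)
    qed blast
    then show ?thesis using Exist wf by (simp add: eval_model)
  next
    case (Neg B)
    then show ?thesis using less by (simp add: Neg_iff)
  next
    case (Imp B C)
    then show ?thesis using less by (simp add: Imp_iff)
  next
    case (All x B)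
    have IH: "sat model (assign(x := val (Const c))) B \<longleftrightarrow> subst B x (Const c) \<in> H"
      if "c \<in> Consts L" for c
      using less.hyps[of "subst B x (Const c)"] less.prems that All
      by (simp add: sat_subst[symmetric] wf_fm_subst)
    show ?thesis
    proof
      assume sat: "sat model assign A"
      show "A \<in> H"
      proof (rule ccontr)
        assume "A \<notin> H"
        then obtain c where c: "c \<in> Consts L" "Exist (Const c) \<in> H" "subst B x (Const c) \<notin> H"
          using All_witness less.prems All by metis
        then show False using sat IH[OF c(1)] All by auto
      qed
    next
      assume "A \<in> H"
      have "sat model (assign(x := val t)) B" if t: "Exist t \<in> H" for t
      proof -
        have wf: "wf_tm L t" using in_H_wf[OF t] by simp
        \<comment> \<open>The term \<open>t\<close> need not be free for \<open>x\<close> in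
          \<open>B\<close>; an equal constant is, and existence carries over to it.\<close>
        obtain c where c: "c \<in> Consts L" "val t = val (Const c)"
          using val_Const[OF wf] .
        then have "Exist (Const c) \<in> H"
          using wf t val_eq_iff[of t "Const c"] Exist_cong by simp
        moreover have "CPFI L {Exist (Const c), All x B} {subst B x (Const c)}"
          by (rule LAll; (rule Ax)?) (use c less.prems All in \<open>auto simp: wf_fm_subst\<close>)
        ultimately have "subst B x (Const c) \<in> H"
          using derivable \<open>A \<in> H\<close> All by blast
        then show ?thesis using IH c by simp
      qed
      then show "sat model assign A" using All by auto
    qed
  next
    case (Iota x B C)
    have IH: "sat model (assign(x := val (Const c))) D \<longleftrightarrow> subst D x (Const c) \<in> H"
      if "c \<in> Consts L" "D = B \<or> D = C" for c D
      using less.hyps[of "subst D x (Const c)"] less.prems that Iota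
      by (auto simp: sat_subst[symmetric] wf_fm_subst)
    have dom: "dom model = (\<lambda>c. val (Const c)) ` Consts L"
    proof (intro equalityI subsetI)
      fix d assume "d \<in> dom model"
      then obtain t where t: "wf_tm L t" "d = val t" by auto
      obtain c where "c \<in> Consts L" "val t = val (Const c)" using val_Const[OF t(1)] .
      with t show "d \<in> (\<lambda>c. val (Const c)) ` Consts L" by auto
    qed auto
    show ?thesis
    proof
      assume "sat model assign A"
      then obtain c where c: "c \<in> Consts L" "sat model (assign(x := val (Const c))) B"
        "sat model (assign(x := val (Const c))) C"
        and u: "\<And>d. d \<in> Consts L \<Longrightarrow> sat model (assign(x := val (Const d))) B \<Longrightarrow>
          val (Const d) = val (Const c)"
        unfolding Iota sat.simps dom by blast
      show "A \<in> H"
        unfolding Iota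
      proof (rule Iota_intro)
        show "Eq (Const d) (Const c) \<in> H" if "d \<in> Consts L" "subst B x (Const d) \<in> H" for d
          using u[of d] that c(1) by (simp add: IH val_eq_iff)
      qed (use c less.prems Iota in \<open>auto simp: IH\<close>)
    next
      assume "A \<in> H"
      then have AH: "Iota x B C \<in> H" using Iota by simp
      obtain c where c: "c \<in> Consts L" "subst B x (Const c) \<in> H" "subst C x (Const c) \<in> H"
        using Iota_witness[OF AH] .
      have "val (Const d) = val (Const c)"
        if "d \<in> Consts L" "sat model (assign(x := val (Const d))) B" for d
        using Iota_unique[OF AH that(1) c(1)] that c by (simp add: IH val_eq_iff)
      then show "sat model assign A"
        unfolding Iota sat.simps dom using c IH by blast
    qed
  qed
qed

end

section \<open>Conservativity of new constants\<close>

text \<open>The sum type keeps the added constants apart from the old ones even if \<open>L\<close>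
  uses up all of \<open>'c\<close>.\<close>

definition ext_lang :: "('c, 'f, 'p) lang \<Rightarrow> 'd set \<Rightarrow> ('c + 'd, 'f, 'p) lang" where
  "ext_lang L D = \<lparr>Consts = Inl ` Consts L \<union> Inr ` D, Funs = Funs L, Preds = Preds L,
     farity = farity L, parity = parity L\<rparr>"

lemma ext_lang_simps [simp]:
  "Consts (ext_lang L D) = Inl ` Consts L \<union> Inr ` D"
  "Funs (ext_lang L D) = Funs L" "Preds (ext_lang L D) = Preds L"
  "farity (ext_lang L D) = farity L" "parity (ext_lang L D) = parity L"
  by (simp_all add: ext_lang_def)

text \<open>New constants are turned into variables because \<open>L\<close> may lack spare
  constants, while variables are never exhausted by a single derivation.\<close>

primrec elim_tm :: "('d \<Rightarrow> var) \<Rightarrow> ('c + 'd, 'f) tm \<Rightarrow> ('c, 'f) tm" where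
  "elim_tm \<sigma> (Var y) = Var y"
| "elim_tm \<sigma> (Const k) = (case k of Inl c \<Rightarrow> Const c | Inr d \<Rightarrow> Var (\<sigma> d))"
| "elim_tm \<sigma> (Fun f ts) = Fun f (map (elim_tm \<sigma>) ts)"

primrec elim_fm :: "('d \<Rightarrow> var) \<Rightarrow> ('c + 'd, 'f, 'p) fm \<Rightarrow> ('c, 'f, 'p) fm" where
  "elim_fm \<sigma> (Pred p ts) = Pred p (map (elim_tm \<sigma>) ts)"
| "elim_fm \<sigma> (Eq t u) = Eq (elim_tm \<sigma> t) (elim_tm \<sigma> u)"
| "elim_fm \<sigma> (Exist t) = Exist (elim_tm \<sigma> t)"
| "elim_fm \<sigma> (Neg A) = Neg (elim_fm \<sigma> A)"
| "elim_fm \<sigma> (Imp A B) = Imp (elim_fm \<sigma> A) (elim_fm \<sigma> B)"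
| "elim_fm \<sigma> (All x A) = All x (elim_fm \<sigma> A)"
| "elim_fm \<sigma> (Iota x A B) = Iota x (elim_fm \<sigma> A) (elim_fm \<sigma> B)"

text \<open>If a new constant of \<open>u\<close> became \<open>x\<close>, the substitution on the
  right-hand side would act on it too.\<close>

lemma elim_subst_tm:
  "(\<And>d. Const (Inr d) \<in> subterms u \<Longrightarrow> \<sigma> d \<noteq> x) \<Longrightarrow>
   elim_tm \<sigma> (subst_tm u x t) = subst_tm (elim_tm \<sigma> u) x (elim_tm \<sigma> t)"
  by (induction u) (auto split: sum.splits)

lemma elim_subst:
  "(\<And>d. Const (Inr d) \<in> terms A \<Longrightarrow> \<sigma> d \<noteq> x) \<Longrightarrow>
   elim_fm \<sigma> (subst A x t) = subst (elim_fm \<sigma> A) x (elim_tm \<sigma> t)"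
  by (induction A) (auto intro!: elim_subst_tm)

lemma vars_elim_tm:
  "y \<in> vars_tm (elim_tm \<sigma> t) \<Longrightarrow> y \<in> vars_tm t \<or> (\<exists>d. Const (Inr d) \<in> subterms t \<and> \<sigma> d = y)"
  by (induction t) (auto split: sum.splits)

lemma fvars_elim_fm:
  "y \<in> fvars (elim_fm \<sigma> A) \<Longrightarrow> y \<in> fvars A \<or> (\<exists>d. Const (Inr d) \<in> terms A \<and> \<sigma> d = y)"
  by (induction A) (auto dest!: vars_elim_tm)

text \<open>The variables that enter through \<open>t\<close> avoid all variables of
  \<open>A\<close>, bound ones included, so no quantifier captures them. Keeping
  \<open>\<sigma> d\<close> distinct from \<open>x\<close> prevents new free occurrences of
  \<open>x\<close> in \<open>A\<close>.\<close>

lemma free_for_elim: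
  assumes "free_for t x A" "\<And>d. Const (Inr d) \<in> terms A \<Longrightarrow> \<sigma> d \<noteq> x"
    and "\<And>d. Const (Inr d) \<in> subterms t \<Longrightarrow> Var (\<sigma> d) \<notin> terms A"
  shows "free_for (elim_tm \<sigma> t) x (elim_fm \<sigma> A)"
  using assms
proof (induction A)
  case (All y A)
  show ?case
  proof (cases "x \<in> fvars (All y A)")
    case True
    then show ?thesis using All by (auto dest!: vars_elim_tm)
  next
    case False
    then have "x \<notin> fvars (elim_fm \<sigma> (All y A))" using All.prems(2) fvars_elim_fm by blast
    then show ?thesis by simp
  qed
next
  case (Iota y A B)
  show ?case
  proof (cases "x \<in> fvars (Iota y A B)")
    case True
    then show ?thesis using Iota by (auto dest!: vars_elim_tm)
  next
    case False
    then have "x \<notin> fvars (elim_fm \<sigma> (Iota y A B))" using Iota.prems(2) fvars_elim_fm by blast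
    then show ?thesis by simp
  qed
qed auto

section \<open>Eigen-terms under the elimination of new constants\<close>

lemma Var_subterms_elim:
  "Var y \<in> subterms (elim_tm \<sigma> t) \<Longrightarrow> Var y \<in> subterms t \<or> (\<exists>d. Const (Inr d) \<in> subterms t \<and> \<sigma> d = y)"
  by (induction t) (auto split: sum.splits)

lemma Var_terms_elim:
  "Var y \<in> terms (elim_fm \<sigma> A) \<Longrightarrow> Var y \<in> terms A \<or> (\<exists>d. Const (Inr d) \<in> terms A \<and> \<sigma> d = y)"
  by (induction A) (auto dest!: Var_subterms_elim)

lemma Const_subterms_elim: "Const c \<in> subterms (elim_tm \<sigma> t) \<Longrightarrow> Const (Inl c) \<in> subterms t"
  by (induction t) (auto split: sum.splits)

lemma Const_terms_elim: "Const c \<in> terms (elim_fm \<sigma> A) \<Longrightarrow> Const (Inl c) \<in> terms A"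
  by (induction A) (auto dest!: Const_subterms_elim)

lemma wf_elim_tm: "wf_tm (ext_lang L D) t \<Longrightarrow> wf_tm L (elim_tm \<sigma> t)"
  by (induction t) (auto simp: list_all_iff)

lemma wf_elim_fm: "wf_fm (ext_lang L D) A \<Longrightarrow> wf_fm L (elim_fm \<sigma> A)"
  by (induction A) (auto simp: list_all_iff wf_elim_tm)

lemma eigen_elim: "eigen (ext_lang L D) a \<Longrightarrow> eigen L (elim_tm \<sigma> a)"
  by (auto simp: eigen_def)

lemma atomic_elim [simp]: "atomic (elim_fm \<sigma> A) = atomic A"
  by (cases A) auto

text \<open>Injectivity protects eigen-terms: if two new constants became the same variable, one of
  them could cease to be absent from the conclusion.\<close>

definition fresh_on :: "('d \<Rightarrow> var) \<Rightarrow> ('c + 'd, 'f) tm set \<Rightarrow> bool" where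
  "fresh_on \<sigma> Z \<longleftrightarrow> inj_on \<sigma> {d. Const (Inr d) \<in> Z} \<and>
     (\<forall>d y. Const (Inr d) \<in> Z \<longrightarrow> Var y \<in> Z \<longrightarrow> \<sigma> d \<noteq> y)"

lemma fresh_on_mono: "fresh_on \<sigma> Z \<Longrightarrow> Z' \<subseteq> Z \<Longrightarrow> fresh_on \<sigma> Z'"
  unfolding fresh_on_def by (metis (mono_tags, lifting) Collect_mono inj_on_subset subsetD)

lemma fresh_onD: "fresh_on \<sigma> Z \<Longrightarrow> Const (Inr d) \<in> Z \<Longrightarrow> Var y \<in> Z \<Longrightarrow> \<sigma> d \<noteq> y"
  by (auto simp: fresh_on_def)

lemma fresh_on_inj:
  "fresh_on \<sigma> Z \<Longrightarrow> \<sigma> d = \<sigma> e \<Longrightarrow> Const (Inr d) \<in> Z \<Longrightarrow> Const (Inr e) \<in> Z \<Longrightarrow> d = e"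
  unfolding fresh_on_def by (auto dest: inj_onD)

text \<open>\<open>T\<close> and \<open>T'\<close> stand for the terms of an expression before and
  after elimination. Whether \<open>a\<close> is a variable, an old constant or a new one, freshness
  leaves \<open>a\<close> itself as the only possible source of its image in
  \<open>T'\<close>.\<close>

lemma eigen_elim_notin:
  assumes "eigen (ext_lang L D) a" and fr: "fresh_on \<sigma> (insert a T)" and "a \<notin> T"
    and V: "\<And>y. Var y \<in> T' \<Longrightarrow> Var y \<in> T \<or> (\<exists>d. Const (Inr d) \<in> T \<and> \<sigma> d = y)"
    and C: "\<And>c. Const c \<in> T' \<Longrightarrow> Const (Inl c) \<in> T"
  shows "elim_tm \<sigma> a \<notin> T'"
proof
  assume T': "elim_tm \<sigma> a \<in> T'"
  from assms(1) consider y where "a = Var y" | c where "a = Const (Inl c)" | d where "a = Const (Inr d)"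
    by (auto simp: eigen_def)
  then show False
  proof cases
    case (1 y)
    then show False using T' V[of y] assms(3) fresh_onD[OF fr, of _ y] by auto
  next
    case (2 c)
    then show False using T' C[of c] assms(3) by auto
  next
    case (3 d)
    then show False
      using T' V[of "\<sigma> d"] assms(3) fresh_onD[OF fr, of d "\<sigma> d"] fresh_on_inj[OF fr, of _ d]
      by auto
  qed
qed

lemma eigen_subterms_elim:
  assumes "eigen (ext_lang L D) a" "fresh_on \<sigma> (insert a (subterms t))" "a \<notin> subterms t"
  shows "elim_tm \<sigma> a \<notin> subterms (elim_tm \<sigma> t)"
  by (rule eigen_elim_notin[OF assms Var_subterms_elim Const_subterms_elim])

lemma eigen_terms_elim:
  assumes "eigen (ext_lang L D) a" "fresh_on \<sigma> (insert a (terms A))" "a \<notin> terms A"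
  shows "elim_tm \<sigma> a \<notin> terms (elim_fm \<sigma> A)"
  by (rule eigen_elim_notin[OF assms Var_terms_elim Const_terms_elim])

lemma eigen_occurs_in_elim:
  assumes "eigen (ext_lang L D) a" "fresh_on \<sigma> (insert a (\<Union> (terms ` \<Gamma>)))" "\<not> occurs_in a \<Gamma>"
  shows "\<not> occurs_in (elim_tm \<sigma> a) (elim_fm \<sigma> ` \<Gamma>)"
proof -
  have "elim_tm \<sigma> a \<notin> terms (elim_fm \<sigma> A)" if "A \<in> \<Gamma>" for A
    by (rule eigen_terms_elim[OF assms(1) fresh_on_mono[OF assms(2)]])
      (use that assms(3) in \<open>auto simp: occurs_in_def\<close>)
  then show ?thesis by (auto simp: occurs_in_def)
qed

text \<open>An eventuality quantifier: finite sets are closed under union, so it commutes with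
  conjunction and the premises of an inference can be combined. The type argument fixes the type of
  the terms in \<open>Z\<close>, which that of \<open>P\<close> leaves open.\<close>

definition almost_all_fresh :: "('c + 'd, 'f) tm itself \<Rightarrow> (('d \<Rightarrow> var) \<Rightarrow> bool) \<Rightarrow> bool" where
  "almost_all_fresh T P \<longleftrightarrow> (\<exists>Z :: ('c + 'd, 'f) tm set. finite Z \<and> (\<forall>\<sigma>. fresh_on \<sigma> Z \<longrightarrow> P \<sigma>))"

lemma almost_all_freshI:
  fixes Z :: "('c + 'd, 'f) tm set"
  assumes "finite Z" "\<And>\<sigma>. fresh_on \<sigma> Z \<Longrightarrow> P \<sigma>"
  shows "almost_all_fresh TYPE(('c + 'd, 'f) tm) P"
  using assms by (auto simp: almost_all_fresh_def)

lemma almost_all_fresh_mp: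
  fixes Z :: "('c + 'd, 'f) tm set"
  assumes "almost_all_fresh TYPE(('c + 'd, 'f) tm) P" "finite Z"
    and "\<And>\<sigma>. fresh_on \<sigma> Z \<Longrightarrow> P \<sigma> \<Longrightarrow> Q \<sigma>"
  shows "almost_all_fresh TYPE(('c + 'd, 'f) tm) Q"
proof -
  from assms(1) obtain Z' :: "('c + 'd, 'f) tm set"
    where "finite Z'" "\<And>\<sigma>. fresh_on \<sigma> Z' \<Longrightarrow> P \<sigma>"
    by (auto simp: almost_all_fresh_def)
  with assms(2,3) show ?thesis
    by (intro almost_all_freshI[of "Z \<union> Z'"]) (auto intro: fresh_on_mono)
qed

lemma almost_all_fresh_conj:
  fixes T :: "('c + 'd, 'f) tm itself"
  assumes "almost_all_fresh T P" "almost_all_fresh T Q"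
  shows "almost_all_fresh T (\<lambda>\<sigma>. P \<sigma> \<and> Q \<sigma>)"
proof -
  from assms obtain Z Z' :: "('c + 'd, 'f) tm set"
    where "finite Z" "\<forall>\<sigma>. fresh_on \<sigma> Z \<longrightarrow> P \<sigma>" "finite Z'" "\<forall>\<sigma>. fresh_on \<sigma> Z' \<longrightarrow> Q \<sigma>"
    unfolding almost_all_fresh_def by blast
  then show ?thesis
    unfolding almost_all_fresh_def
    by (intro exI[of _ "Z \<union> Z'"]) (auto intro: fresh_on_mono)
qed

text \<open>The new constants become variables avoiding all terms of the derivation. Which terms have to be
  avoided is left open during the induction: each inference adds finitely many.\<close>

lemma CPFI_elim:
  fixes L :: "('c, 'f, 'p) lang" and D :: "'d set"
  assumes "CPFI (ext_lang L D) \<Gamma> \<Delta>"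
  shows "almost_all_fresh TYPE(('c + 'd, 'f) tm)
    (\<lambda>\<sigma>. CPFI L (elim_fm \<sigma> ` \<Gamma>) (elim_fm \<sigma> ` \<Delta>))"
  using assms
proof (induction rule: CPFI.induct)
  case (Ax A)
  show ?case
    by (rule almost_all_freshI[of "{}"]) (use Ax in \<open>auto intro: CPFI.Ax wf_elim_fm\<close>)
next
  case (Cut \<Gamma> A \<Delta> \<Gamma>' \<Delta>')
  show ?case
    by (rule almost_all_fresh_mp[OF almost_all_fresh_conj[OF Cut.IH], of "{}"])
      (auto simp: image_Un intro: CPFI.Cut)
next
  case (LW \<Gamma> \<Delta> A)
  show ?case
    by (rule almost_all_fresh_mp[OF LW.IH, of "{}"])
      (use LW.hyps in \<open>auto intro: CPFI.LW wf_elim_fm\<close>)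
next
  case (RW \<Gamma> \<Delta> A)
  show ?case
    by (rule almost_all_fresh_mp[OF RW.IH, of "{}"])
      (use RW.hyps in \<open>auto intro: CPFI.RW wf_elim_fm\<close>)
next
  case (LNeg \<Gamma> A \<Delta>)
  show ?case
    by (rule almost_all_fresh_mp[OF LNeg.IH, of "{}"]) (auto intro: CPFI.LNeg)
next
  case (RNeg A \<Gamma> \<Delta>)
  show ?case
    by (rule almost_all_fresh_mp[OF RNeg.IH, of "{}"]) (auto intro: CPFI.RNeg)
next
  case (LImp \<Gamma> A \<Delta> B)
  show ?case
    by (rule almost_all_fresh_mp[OF almost_all_fresh_conj[OF LImp.IH], of "{}"])
      (auto intro: CPFI.LImp)
next
  case (RImp A \<Gamma> B \<Delta>)
  show ?case
    by (rule almost_all_fresh_mp[OF RImp.IH, of "{}"]) (auto intro: CPFI.RImp)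
next
  case (LAll A x t \<Gamma> \<Delta>)
  show ?case
  proof (rule almost_all_fresh_mp[OF LAll.IH, of "subterms t \<union> insert (Var x) (terms A)"])
    show "finite (subterms t \<union> insert (Var x) (terms A))"
      by (simp add: finite_subterms finite_terms)
    fix \<sigma> :: "'d \<Rightarrow> var"
    assume fr: "fresh_on \<sigma> (subterms t \<union> insert (Var x) (terms A))"
      and IH: "CPFI L (elim_fm \<sigma> ` insert (subst A x t) \<Gamma>) (elim_fm \<sigma> ` \<Delta>)"
    have "elim_fm \<sigma> (subst A x t) = subst (elim_fm \<sigma> A) x (elim_tm \<sigma> t)"
      by (rule elim_subst) (use fr in \<open>auto dest: fresh_onD\<close>)
    moreover have "free_for (elim_tm \<sigma> t) x (elim_fm \<sigma> A)"
      by (rule free_for_elim[OF LAll.hyps(3)]) (use fr in \<open>auto dest: fresh_onD\<close>)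
    ultimately show "CPFI L (elim_fm \<sigma> ` insert (Exist t) (insert (All x A) \<Gamma>)) (elim_fm \<sigma> ` \<Delta>)"
      using IH CPFI.LAll[OF _ wf_elim_tm[OF LAll.hyps(2)]] by simp
  qed
next
  case (RAll a \<Gamma> A x \<Delta>)
  \<comment> \<open>Freshness for the eigen-term and all terms of the conclusion transfers the
    eigen-term condition to the image.\<close>
  let ?Z = "insert a (\<Union> (terms ` insert (All x A) (\<Gamma> \<union> \<Delta>)))"
  show ?case
  proof (rule almost_all_fresh_mp[OF RAll.IH, of ?Z])
    show "finite ?Z"
      using CPFI_wf[OF RAll.hyps(1)] by (simp add: finite_terms)
    fix \<sigma> :: "'d \<Rightarrow> var"
    assume fr: "fresh_on \<sigma> ?Z"
      and IH: "CPFI L (elim_fm \<sigma> ` insert (Exist a) \<Gamma>) (elim_fm \<sigma> ` insert (subst A x a) \<Delta>)"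
    have "elim_fm \<sigma> (subst A x a) = subst (elim_fm \<sigma> A) x (elim_tm \<sigma> a)"
      by (rule elim_subst) (use fr in \<open>auto dest: fresh_onD\<close>)
    moreover have "\<not> occurs_in (elim_tm \<sigma> a) (elim_fm \<sigma> ` insert (All x A) (\<Gamma> \<union> \<Delta>))"
      by (rule eigen_occurs_in_elim[OF RAll.hyps(2) fr RAll.hyps(3)])
    ultimately show "CPFI L (elim_fm \<sigma> ` \<Gamma>) (elim_fm \<sigma> ` insert (All x A) \<Delta>)"
      using IH CPFI.RAll[OF _ eigen_elim[OF RAll.hyps(2), of \<sigma>]] by (simp add: image_Un)
  qed
next
  case (EqSubst A x t\<^sub>2 \<Gamma> \<Delta> t\<^sub>1)
  show ?case
  proof (rule almost_all_fresh_mp[OF EqSubst.IH, of "insert (Var x) (terms A)"])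
    show "finite (insert (Var x) (terms A))"
      by (simp add: finite_terms)
    fix \<sigma> :: "'d \<Rightarrow> var"
    assume fr: "fresh_on \<sigma> (insert (Var x) (terms A))"
      and IH: "CPFI L (elim_fm \<sigma> ` insert (subst A x t\<^sub>2) \<Gamma>) (elim_fm \<sigma> ` \<Delta>)"
    have "elim_fm \<sigma> (subst A x t) = subst (elim_fm \<sigma> A) x (elim_tm \<sigma> t)" for t
      by (rule elim_subst) (use fr in \<open>auto dest: fresh_onD\<close>)
    then show "CPFI L (elim_fm \<sigma> ` insert (Eq t\<^sub>1 t\<^sub>2) (insert (subst A x t\<^sub>1) \<Gamma>)) (elim_fm \<sigma> ` \<Delta>)"
      using IH CPFI.EqSubst[of L "elim_fm \<sigma> A" x "elim_tm \<sigma> t\<^sub>2" _ _ "elim_tm \<sigma> t\<^sub>1"] EqSubst.hyps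
      by (simp add: wf_elim_tm)
  qed
next
  case (EqRefl t \<Gamma> \<Delta>)
  show ?case
    by (rule almost_all_fresh_mp[OF EqRefl.IH, of "{}"]) (auto intro: CPFI.EqRefl)
next
  case (RI \<Gamma> A x t \<Delta> B a)
  \<comment> \<open>The term \<open>t\<close> may be absent from the conclusion, but the images of
    \<open>a\<close> and \<open>t\<close> must stay apart and \<open>t\<close> must remain free for
    \<open>x\<close>.\<close>
  let ?Z = "subterms t \<union> insert a (\<Union> (terms ` insert (Iota x A B) (\<Gamma> \<union> \<Delta>)))"
  show ?case
  proof (rule almost_all_fresh_mp[OF almost_all_fresh_conj[OF RI.IH(1)
          almost_all_fresh_conj[OF RI.IH(2,3)]], of ?Z])
    show "finite ?Z"
      using CPFI_wf[OF RI.hyps(1)] by (simp add: finite_terms finite_subterms)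
    fix \<sigma> :: "'d \<Rightarrow> var"
    assume fr: "fresh_on \<sigma> ?Z"
      and IH: "CPFI L (elim_fm \<sigma> ` \<Gamma>) (elim_fm \<sigma> ` insert (subst A x t) \<Delta>) \<and>
        CPFI L (elim_fm \<sigma> ` \<Gamma>) (elim_fm \<sigma> ` insert (subst B x t) \<Delta>) \<and>
        CPFI L (elim_fm \<sigma> ` insert (subst A x a) \<Gamma>) (elim_fm \<sigma> ` insert (Eq a t) \<Delta>)"
    have A: "elim_fm \<sigma> (subst A x u) = subst (elim_fm \<sigma> A) x (elim_tm \<sigma> u)" for u
      by (rule elim_subst) (use fr in \<open>auto dest: fresh_onD\<close>)
    have B: "elim_fm \<sigma> (subst B x t) = subst (elim_fm \<sigma> B) x (elim_tm \<sigma> t)"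
      by (rule elim_subst) (use fr in \<open>auto dest: fresh_onD\<close>)
    have ffA: "free_for (elim_tm \<sigma> t) x (elim_fm \<sigma> A)"
      by (rule free_for_elim) (use fr RI.hyps in \<open>auto dest: fresh_onD\<close>)
    have ffB: "free_for (elim_tm \<sigma> t) x (elim_fm \<sigma> B)"
      by (rule free_for_elim) (use fr RI.hyps in \<open>auto dest: fresh_onD\<close>)
    have occ: "\<not> occurs_in (elim_tm \<sigma> a) (elim_fm \<sigma> ` insert (Iota x A B) (\<Gamma> \<union> \<Delta>))"
      by (rule eigen_occurs_in_elim[OF RI.hyps(6) fresh_on_mono[OF fr] RI.hyps(7)]) auto
    have "elim_tm \<sigma> a \<notin> subterms (elim_tm \<sigma> t)"
      by (rule eigen_subterms_elim[OF RI.hyps(6) fresh_on_mono[OF fr] RI.hyps(8)]) auto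
    then show "CPFI L (elim_fm \<sigma> ` \<Gamma>) (elim_fm \<sigma> ` insert (Iota x A B) \<Delta>)"
      using IH ffA ffB occ CPFI.RI[OF _ _ _ ffA ffB eigen_elim[OF RI.hyps(6), of \<sigma>]]
      by (simp add: A B image_Un)
  qed
next
  case (LI1 A x a B \<Gamma> \<Delta>)
  let ?Z = "insert a (\<Union> (terms ` insert (Iota x A B) (\<Gamma> \<union> \<Delta>)))"
  show ?case
  proof (rule almost_all_fresh_mp[OF LI1.IH, of ?Z])
    show "finite ?Z"
      using CPFI_wf[OF LI1.hyps(1)] by (simp add: finite_terms)
    fix \<sigma> :: "'d \<Rightarrow> var"
    assume fr: "fresh_on \<sigma> ?Z"
      and IH: "CPFI L (elim_fm \<sigma> ` insert (subst A x a) (insert (subst B x a) \<Gamma>)) (elim_fm \<sigma> ` \<Delta>)"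
    have A: "elim_fm \<sigma> (subst A x a) = subst (elim_fm \<sigma> A) x (elim_tm \<sigma> a)"
      by (rule elim_subst) (use fr in \<open>auto dest: fresh_onD\<close>)
    have B: "elim_fm \<sigma> (subst B x a) = subst (elim_fm \<sigma> B) x (elim_tm \<sigma> a)"
      by (rule elim_subst) (use fr in \<open>auto dest: fresh_onD\<close>)
    have "\<not> occurs_in (elim_tm \<sigma> a) (elim_fm \<sigma> ` insert (Iota x A B) (\<Gamma> \<union> \<Delta>))"
      by (rule eigen_occurs_in_elim[OF LI1.hyps(2) fr LI1.hyps(3)])
    then show "CPFI L (elim_fm \<sigma> ` insert (Iota x A B) \<Gamma>) (elim_fm \<sigma> ` \<Delta>)"
      using IH CPFI.LI1[OF _ eigen_elim[OF LI1.hyps(2), of \<sigma>]] by (simp add: A B image_Un)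
  qed
next
  case (LI2 \<Gamma> A x t\<^sub>1 \<Delta> t\<^sub>2 C B)
  let ?Z = "subterms t\<^sub>1 \<union> subterms t\<^sub>2 \<union> insert (Var x) (terms A \<union> terms C)"
  show ?case
  proof (rule almost_all_fresh_mp[OF almost_all_fresh_conj[OF LI2.IH(1)
          almost_all_fresh_conj[OF LI2.IH(2,3)]], of ?Z])
    show "finite ?Z"
      by (simp add: finite_terms finite_subterms)
    fix \<sigma> :: "'d \<Rightarrow> var"
    assume fr: "fresh_on \<sigma> ?Z"
      and IH: "CPFI L (elim_fm \<sigma> ` \<Gamma>) (elim_fm \<sigma> ` insert (subst A x t\<^sub>1) \<Delta>) \<and>
        CPFI L (elim_fm \<sigma> ` \<Gamma>) (elim_fm \<sigma> ` insert (subst A x t\<^sub>2) \<Delta>) \<and>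
        CPFI L (elim_fm \<sigma> ` \<Gamma>) (elim_fm \<sigma> ` insert (subst C x t\<^sub>2) \<Delta>)"
    have A: "elim_fm \<sigma> (subst A x u) = subst (elim_fm \<sigma> A) x (elim_tm \<sigma> u)" for u
      by (rule elim_subst) (use fr in \<open>auto dest: fresh_onD\<close>)
    have C: "elim_fm \<sigma> (subst C x u) = subst (elim_fm \<sigma> C) x (elim_tm \<sigma> u)" for u
      by (rule elim_subst) (use fr in \<open>auto dest: fresh_onD\<close>)
    have ff1: "free_for (elim_tm \<sigma> t\<^sub>1) x (elim_fm \<sigma> A)"
      by (rule free_for_elim) (use fr LI2.hyps in \<open>auto dest: fresh_onD\<close>)
    have ff2: "free_for (elim_tm \<sigma> t\<^sub>2) x (elim_fm \<sigma> A)"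
      by (rule free_for_elim) (use fr LI2.hyps in \<open>auto dest: fresh_onD\<close>)
    show "CPFI L (elim_fm \<sigma> ` insert (Iota x A B) \<Gamma>) (elim_fm \<sigma> ` insert (subst C x t\<^sub>1) \<Delta>)"
      using IH CPFI.LI2[OF _ _ _ wf_elim_tm[OF LI2.hyps(4)] wf_elim_tm[OF LI2.hyps(5)]
          wf_elim_fm[OF LI2.hyps(6)] ff1 ff2, of "elim_fm \<sigma> ` \<Gamma>" "elim_fm \<sigma> ` \<Delta>" "elim_fm \<sigma> C"]
        LI2.hyps(9)
      by (simp add: A C)
  qed
qed

lemma fresh_on_exists:
  fixes Z :: "('c + 'd, 'f) tm set"
  assumes "finite Z"
  obtains \<sigma> :: "'d \<Rightarrow> var" where "fresh_on \<sigma> Z"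
proof -
  have "finite {d. Const (Inr d) \<in> Z}"
    using finite_vimageI[OF assms, of "\<lambda>d. Const (Inr d)"] by (simp add: inj_def vimage_def)
  moreover have fV: "finite {y. Var y \<in> Z}"
    using finite_vimageI[OF assms, of Var] by (simp add: inj_def vimage_def)
  moreover have "infinite (- {y. Var y \<in> Z})"
    using fV by (simp add: Compl_eq_Diff_UNIV)
  then obtain B where "finite B" "card B = card {d. Const (Inr d) \<in> Z}" "B \<subseteq> - {y. Var y \<in> Z}"
    using infinite_arbitrarily_large by blast
  ultimately obtain \<sigma> where "bij_betw \<sigma> {d. Const (Inr d) \<in> Z} B"
    using finite_same_card_bij by metis
  with \<open>B \<subseteq> _\<close> have "fresh_on \<sigma> Z"
    unfolding fresh_on_def bij_betw_def by blast
  then show ?thesis by (rule that)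
qed

lemma elim_tm_map [simp]: "elim_tm \<sigma> (map_tm Inl id t) = t"
  by (induction t) (auto simp: map_idI)

lemma elim_fm_map [simp]: "elim_fm \<sigma> (map_fm Inl id id A) = A"
  by (induction A) (auto simp: map_idI elim_tm_map[unfolded id_def])

text \<open>Elimination undoes the embedding whatever \<open>\<sigma>\<close> is, so one
  \<open>\<sigma>\<close> fresh for the derivation returns the original sequent.\<close>

lemma CPFI_conservative:
  fixes L :: "('c, 'f, 'p) lang" and D :: "'d set"
  assumes "CPFI (ext_lang L D) (map_fm Inl id id ` \<Gamma>) (map_fm Inl id id ` \<Delta>)"
  shows "CPFI L \<Gamma> \<Delta>"
proof -
  obtain Z :: "('c + 'd, 'f) tm set" where Z: "finite Z"
    "\<And>\<sigma>. fresh_on \<sigma> Z \<Longrightarrow> CPFI L (elim_fm \<sigma> ` map_fm Inl id id ` \<Gamma>)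
      (elim_fm \<sigma> ` map_fm Inl id id ` \<Delta>)"
    using CPFI_elim[OF assms] by (auto simp: almost_all_fresh_def)
  obtain \<sigma> :: "'d \<Rightarrow> var" where "fresh_on \<sigma> Z"
    using fresh_on_exists[OF Z(1)] by blast
  from Z(2)[OF this] show ?thesis by (simp add: image_image)
qed

section \<open>Counting formulas\<close>

text \<open>A pairing on \<open>B\<close>, numerals as tags and codes for the symbols suffice to
  code all formulas injectively in \<open>B\<close>. This bounds the number of formulas of the
  extended language.\<close>

locale lang_code =
  fixes L :: "('c, 'f, 'p) lang" and B :: "'b set" and pair :: "'b \<Rightarrow> 'b \<Rightarrow> 'b" and num :: "nat \<Rightarrow> 'b"
    and kc :: "'c \<Rightarrow> 'b" and kf :: "'f \<Rightarrow> 'b" and kp :: "'p \<Rightarrow> 'b"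
  assumes pair_in: "a \<in> B \<Longrightarrow> b \<in> B \<Longrightarrow> pair a b \<in> B"
    and pair_eq: "a \<in> B \<Longrightarrow> b \<in> B \<Longrightarrow> a' \<in> B \<Longrightarrow> b' \<in> B \<Longrightarrow> pair a b = pair a' b' \<longleftrightarrow> a = a' \<and> b = b'"
    and num_in: "num i \<in> B" and num_eq: "num i = num j \<longleftrightarrow> i = j"
    and kc_in: "c \<in> Consts L \<Longrightarrow> kc c \<in> B" and kc_inj: "inj_on kc (Consts L)"
    and kf_in: "f \<in> Funs L \<Longrightarrow> kf f \<in> B" and kf_inj: "inj_on kf (Funs L)"
    and kp_in: "P \<in> Preds L \<Longrightarrow> kp P \<in> B" and kp_inj: "inj_on kp (Preds L)"
begin

text \<open>\<open>num 0\<close> may itself be a pair, so codes are compared only between lists of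
  equal length; for arguments the symbol determines the length.\<close>

primrec code_list :: "'b list \<Rightarrow> 'b" where
  "code_list [] = num 0"
| "code_list (x # xs) = pair x (code_list xs)"

primrec code_tm :: "('c, 'f) tm \<Rightarrow> 'b" where
  "code_tm (Var y) = pair (num 0) (num y)"
| "code_tm (Const c) = pair (num 1) (kc c)"
| "code_tm (Fun f ts) = pair (num 2) (pair (kf f) (code_list (map code_tm ts)))"

primrec code_fm :: "('c, 'f, 'p) fm \<Rightarrow> 'b" where
  "code_fm (Pred P ts) = pair (num 0) (pair (kp P) (code_list (map code_tm ts)))"
| "code_fm (Eq t u) = pair (num 1) (pair (code_tm t) (code_tm u))"
| "code_fm (Exist t) = pair (num 2) (code_tm t)"
| "code_fm (Neg A) = pair (num 3) (code_fm A)"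
| "code_fm (Imp A C) = pair (num 4) (pair (code_fm A) (code_fm C))"
| "code_fm (All x A) = pair (num 5) (pair (num x) (code_fm A))"
| "code_fm (Iota x A C) = pair (num 6) (pair (num x) (pair (code_fm A) (code_fm C)))"

lemmas code_simps = pair_in pair_eq num_in num_eq kc_in kf_in kp_in

lemma code_list_in: "set xs \<subseteq> B \<Longrightarrow> code_list xs \<in> B"
  by (induction xs) (auto simp: code_simps)

lemma code_list_inj:
  assumes "length xs = length ys" "set xs \<subseteq> B" "set ys \<subseteq> B" "code_list xs = code_list ys"
  shows "xs = ys"
  using assms by (induction xs ys rule: list_induct2) (auto simp: code_simps code_list_in)

lemma code_tm_in: "wf_tm L t \<Longrightarrow> code_tm t \<in> B"
proof (induction t)
  case (Fun f ts)
  then have "code_list (map code_tm ts) \<in> B" by (intro code_list_in) (auto simp: list_all_iff)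
  with Fun show ?case by (simp add: code_simps)
qed (auto simp: code_simps)

lemma code_tms_in: "list_all (wf_tm L) ts \<Longrightarrow> code_list (map code_tm ts) \<in> B"
  by (intro code_list_in) (auto simp: list_all_iff code_tm_in)

lemma map_code_inj:
  assumes "length ts = length us" "list_all (wf_tm L) ts" "list_all (wf_tm L) us"
    and "code_list (map code_tm ts) = code_list (map code_tm us)"
    and "\<And>t u. t \<in> set ts \<Longrightarrow> u \<in> set us \<Longrightarrow> code_tm t = code_tm u \<Longrightarrow> t = u"
  shows "ts = us"
proof -
  have "map code_tm ts = map code_tm us"
    by (rule code_list_inj) (use assms in \<open>auto simp: list_all_iff code_tm_in\<close>)
  then have "list_all2 (\<lambda>t u. code_tm t = code_tm u) ts us"
    by (simp add: list_all2_conv_all_nth list_eq_iff_nth_eq)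
  then show ?thesis
    using assms(5) by (induction rule: list_all2_induct) auto
qed

lemma code_tm_inj: "wf_tm L t \<Longrightarrow> wf_tm L u \<Longrightarrow> code_tm t = code_tm u \<Longrightarrow> t = u"
proof (induction t arbitrary: u)
  case (Var y)
  then show ?case by (cases u) (auto simp: code_simps code_tms_in)
next
  case (Const c)
  then show ?case using kc_inj by (cases u) (auto simp: code_simps code_tms_in dest: inj_onD)
next
  case (Fun f ts)
  show ?case
  proof (cases u)
    case (Fun g us)
    have wf: "f \<in> Funs L" "g \<in> Funs L" "list_all (wf_tm L) ts" "list_all (wf_tm L) us"
      "length ts = farity L f" "length us = farity L g"
      using Fun.prems \<open>u = Fun g us\<close> by auto
    have eq: "kf f = kf g" "code_list (map code_tm ts) = code_list (map code_tm us)"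
      using Fun.prems(3) wf \<open>u = Fun g us\<close> by (auto simp: code_simps code_tms_in)
    have "f = g" using eq(1) wf kf_inj by (auto dest: inj_onD)
    moreover have "ts = us"
      by (rule map_code_inj[OF _ wf(3,4) eq(2)])
        (use wf \<open>f = g\<close> Fun.IH in \<open>auto simp: list_all_iff\<close>)
    ultimately show ?thesis using \<open>u = Fun g us\<close> by simp
  qed (use Fun.prems in \<open>auto simp: code_simps code_tms_in\<close>)
qed

lemma code_fm_in: "wf_fm L A \<Longrightarrow> code_fm A \<in> B"
  by (induction A) (auto simp: code_simps code_tm_in code_tms_in)

lemma code_fm_inj: "wf_fm L A \<Longrightarrow> wf_fm L A' \<Longrightarrow> code_fm A = code_fm A' \<Longrightarrow> A = A'"
proof (induction A arbitrary: A')
  case (Pred P ts)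
  show ?case
  proof (cases A')
    case (Pred Q us)
    have wf: "P \<in> Preds L" "Q \<in> Preds L" "list_all (wf_tm L) ts" "list_all (wf_tm L) us"
      "length ts = parity L P" "length us = parity L Q"
      using Pred.prems \<open>A' = Pred Q us\<close> by auto
    have eq: "kp P = kp Q" "code_list (map code_tm ts) = code_list (map code_tm us)"
      using Pred.prems(3) wf \<open>A' = Pred Q us\<close> by (auto simp: code_simps code_tms_in)
    have "P = Q" using eq(1) wf kp_inj by (auto dest: inj_onD)
    moreover have "ts = us"
      by (rule map_code_inj[OF _ wf(3,4) eq(2)])
        (use wf \<open>P = Q\<close> code_tm_inj in \<open>auto simp: list_all_iff\<close>)
    ultimately show ?thesis using \<open>A' = Pred Q us\<close> by simp
  qed (use Pred.prems in \<open>auto simp: code_simps code_tm_in code_tms_in code_fm_in\<close>)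
next
  case (Eq t u)
  then show ?case
    by (cases A') (auto simp: code_simps code_tm_in code_tms_in code_fm_in intro: code_tm_inj)
next
  case (Exist t)
  then show ?case
    by (cases A') (auto simp: code_simps code_tm_in code_tms_in code_fm_in intro: code_tm_inj)
next
  case (Neg A)
  then show ?case
    by (cases A') (auto simp: code_simps code_tm_in code_tms_in code_fm_in)
next
  case (Imp A C)
  then show ?case
    by (cases A') (auto simp: code_simps code_tm_in code_tms_in code_fm_in)
next
  case (All x A)
  then show ?case
    by (cases A') (auto simp: code_simps code_tm_in code_tms_in code_fm_in)
next
  case (Iota x A C)
  then show ?case
    by (cases A') (auto simp: code_simps code_tm_in code_tms_in code_fm_in)
qed

lemma formulas_inj: "inj_on code_fm (formulas L)"
  by (rule inj_onI) (auto simp: formulas_def intro: code_fm_inj)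

end

text \<open>The set of \<open>L\<close>-formulas is infinite, hence equinumerous with its square.
  The resulting pairing codes extended formulas by \<open>L\<close>-formulas, as the new constants
  are themselves pairs of a number and an \<open>L\<close>-formula.\<close>

lemma ext_lang_formulas_inj:
  fixes L :: "('c, 'f, 'p) lang"
  obtains code where
    "inj_on code (formulas (ext_lang L (UNIV \<times> formulas L :: (nat \<times> ('c, 'f, 'p) fm) set)))"
    "code ` formulas (ext_lang L (UNIV \<times> formulas L :: (nat \<times> ('c, 'f, 'p) fm) set)) \<subseteq> formulas L"
proof -
  let ?B = "formulas L"
  \<comment> \<open>These formulas exist in every language; they serve as numerals and show that the
    set is infinite.\<close>
  let ?num = "\<lambda>i. Exist (Var i) :: ('c, 'f, 'p) fm"
  have "range ?num \<subseteq> ?B" "inj ?num" by (auto simp: formulas_def inj_def)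
  then have "infinite ?B" using infinite_iff_countable_subset by blast
  then have "(card_of (?B \<times> ?B), card_of ?B) \<in> ordIso" by (rule card_of_Times_same_infinite)
  then obtain q where "bij_betw q (?B \<times> ?B) ?B" using card_of_ordIso by blast
  then have q: "inj_on q (?B \<times> ?B)" "q ` (?B \<times> ?B) = ?B" by (auto simp: bij_betw_def)
  define pair where "pair a b = q (a, b)" for a b
  have pair_in: "pair a b \<in> ?B" if "a \<in> ?B" "b \<in> ?B" for a b
    using q(2) that unfolding pair_def by blast
  have pair_eq: "pair a b = pair a' b' \<longleftrightarrow> a = a' \<and> b = b'"
    if "a \<in> ?B" "b \<in> ?B" "a' \<in> ?B" "b' \<in> ?B" for a b a' b'
    unfolding pair_def using inj_on_eq_iff[OF q(1), of "(a, b)" "(a', b')"] that by simp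
  have num_in: "?num i \<in> ?B" for i by (simp add: formulas_def)
  \<comment> \<open>The tags \<open>0\<close> and \<open>1\<close> separate old constants from new
    ones.\<close>
  define kc :: "'c + nat \<times> ('c, 'f, 'p) fm \<Rightarrow> ('c, 'f, 'p) fm" where
    "kc = case_sum (\<lambda>c. pair (?num 0) (Exist (Const c))) (\<lambda>(i, A). pair (?num 1) (pair (?num i) A))"
  have const_in: "Exist (Const c) \<in> ?B" if "c \<in> Consts L" for c
    using that by (simp add: formulas_def)
  \<comment> \<open>A function or predicate symbol is coded by its application to copies of
    \<open>Var 0\<close>, as many as its arity demands, so that the code is an
    \<open>L\<close>-formula.\<close>
  interpret lang_code "ext_lang L (UNIV \<times> ?B :: (nat \<times> ('c, 'f, 'p) fm) set)" ?B pair ?num kc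
    "\<lambda>f. Exist (Fun f (replicate (farity L f) (Var 0)))"
    "\<lambda>P. Pred P (replicate (parity L P) (Var 0))"
  proof
    show "kc c \<in> ?B" if "c \<in> Consts (ext_lang L (UNIV \<times> ?B))" for c
      using that by (auto simp: kc_def pair_in num_in const_in)
    show "inj_on kc (Consts (ext_lang L (UNIV \<times> ?B)))"
      by (rule inj_onI) (auto simp: kc_def pair_in pair_eq num_in const_in)
  qed (use pair_in pair_eq num_in in
      \<open>auto simp: formulas_def inj_on_def list_all_iff\<close>)
  show ?thesis
  proof (rule that[OF formulas_inj])
    show "code_fm ` formulas (ext_lang L (UNIV \<times> ?B)) \<subseteq> ?B"
      using code_fm_in by (auto simp: formulas_def)
  qed
qed

section \<open>Completeness\<close>

lemma wf_map_tm: "wf_tm L t \<Longrightarrow> wf_tm (ext_lang L D) (map_tm Inl id t)"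
  by (induction t) (auto simp: list_all_iff id_def)

lemma wf_map_fm: "wf_fm L A \<Longrightarrow> wf_fm (ext_lang L D) (map_fm Inl id id A)"
  by (induction A) (auto simp: list_all_iff wf_map_tm)

lemma Const_subterms_map: "Const k \<in> subterms (map_tm Inl id t) \<Longrightarrow> k \<in> range Inl"
  by (induction t) (auto simp: id_def)

lemma Const_terms_map: "Const k \<in> terms (map_fm Inl id id A) \<Longrightarrow> k \<in> range Inl"
  by (induction A) (auto dest!: Const_subterms_map)

definition reduct :: "('u, 'c + 'd, 'f, 'p) struct \<Rightarrow> ('u, 'c, 'f, 'p) struct" where
  "reduct M = \<lparr>dom = dom M, inner = inner M, predI = predI M, constI = (\<lambda>c. constI M (Inl c)),
     funI = funI M\<rparr>"

lemma reduct_simps [simp]: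
  "dom (reduct M) = dom M" "inner (reduct M) = inner M" "predI (reduct M) = predI M"
  "constI (reduct M) c = constI M (Inl c)" "funI (reduct M) = funI M"
  by (simp_all add: reduct_def)

lemma is_struct_reduct: "is_struct (ext_lang L D) M \<Longrightarrow> is_struct L (reduct M)"
  unfolding is_struct_def by simp

lemma eval_reduct: "eval_tm M s (map_tm Inl id t) = eval_tm (reduct M) s t"
proof (induction t)
  case (Fun f ts)
  then show ?case by (auto simp: id_def o_def cong: map_cong)
qed auto

lemma sat_reduct: "sat M s (map_fm Inl id id A) \<longleftrightarrow> sat (reduct M) s A"
  by (induction A arbitrary: s) (auto simp: o_def eval_reduct)

text \<open>By conservativity a refutation in the extended language descends to \<open>L\<close>,
  where moving \<open>Neg A\<close> to the right gives a derivation of \<open>A\<close> from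
  finitely many members of \<open>\<Gamma>\<close>.\<close>

lemma consistent_ext:
  assumes "\<Gamma> \<subseteq> formulas L" "A \<in> formulas L" "\<not> provable L \<Gamma> A"
  shows "consistent (ext_lang L D) (map_fm Inl id id ` insert (Neg A) \<Gamma>)"
proof -
  have "\<not> CPFI (ext_lang L D) F {}" if F: "F \<subseteq> map_fm Inl id id ` insert (Neg A) \<Gamma>" for F
  proof
    assume "CPFI (ext_lang L D) F {}"
    moreover obtain F0 where F0: "F0 \<subseteq> insert (Neg A) \<Gamma>" "F = map_fm Inl id id ` F0"
      using F by (meson subset_image_iff)
    ultimately have der: "CPFI L F0 {}"
      using CPFI_conservative[of L D F0 "{}"] by simp
    have "CPFI L (insert (Neg A) (F0 - {Neg A})) {}"
      by (rule CPFI_weaken[OF der])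
        (use CPFI_wf[OF der] assms(2) in \<open>auto simp: formulas_def\<close>)
    then have "CPFI L (F0 - {Neg A}) {A}"
      by (rule CPFI_Neg_left)
    moreover have "finite (F0 - {Neg A})" "F0 - {Neg A} \<subseteq> \<Gamma>"
      using CPFI_wf[OF der] F0 by auto
    ultimately show False
      using assms(3) unfolding provable_def by blast
  qed
  moreover have "map_fm Inl id id ` insert (Neg A) \<Gamma> \<subseteq> formulas (ext_lang L D)"
  proof (rule image_subsetI)
    fix B assume "B \<in> insert (Neg A) \<Gamma>"
    then have "wf_fm L B" using assms(1,2) by (auto simp: formulas_def)
    then show "map_fm Inl id id B \<in> formulas (ext_lang L D)"
      unfolding formulas_def by (simp add: wf_map_fm del: fm.map)
  qed
  ultimately show ?thesis unfolding consistent_def by blast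
qed

fun const_level :: "'c + nat \<times> 'b \<Rightarrow> nat" where
  "const_level (Inl c) = 0"
| "const_level (Inr (n, b)) = n"

text \<open>The default \<open>0\<close> gives \<open>Max\<close> a nonempty set when no constants
  occur.\<close>

definition level :: "('c + nat \<times> 'b, 'f, 'p) fm \<Rightarrow> nat" where
  "level A = Max (insert 0 (const_level ` fm_consts A))"

lemma const_level_le:
  assumes "c \<in> fm_consts A"
  shows "const_level c \<le> level A"
proof -
  have "finite (fm_consts A)"
    using finite_vimageI[OF finite_terms, of Const A] by (simp add: inj_def vimage_def)
  with assms show ?thesis
    unfolding level_def by (intro Max_ge) auto
qed

theorem theorem7:
  fixes L :: "('c, 'f, 'p) lang"
    and \<Gamma> :: "('c, 'f, 'p) fm set"
    and A :: "('c, 'f, 'p) fm"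
  assumes "\<Gamma> \<subseteq> formulas L" and "A \<in> formulas L"
    and universe: "\<exists>e :: ('c, 'f, 'p) fm \<Rightarrow> 'u. inj_on e (formulas L)"
    and "entails TYPE('u) L \<Gamma> A"
  shows "provable L \<Gamma> A"
proof (rule ccontr)
  assume np: "\<not> provable L \<Gamma> A"
  let ?D = "UNIV \<times> formulas L :: (nat \<times> ('c, 'f, 'p) fm) set"
  let ?L = "ext_lang L ?D"
  let ?\<iota> = "map_fm Inl id id :: ('c, 'f, 'p) fm \<Rightarrow> ('c + nat \<times> ('c, 'f, 'p) fm, 'f, 'p) fm"
  obtain e :: "('c, 'f, 'p) fm \<Rightarrow> 'u" where e: "inj_on e (formulas L)"
    using universe by blast
  obtain code where code: "inj_on code (formulas ?L)" "code ` formulas ?L \<subseteq> formulas L"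
    by (rule ext_lang_formulas_inj)
  \<comment> \<open>\<open>Suc\<close> puts the witness strictly above every constant of
    \<open>\<phi>\<close> and of formulas of no higher level; \<open>code \<phi>\<close> gives
    different formulas different witnesses.\<close>
  define w :: "('c + nat \<times> ('c, 'f, 'p) fm, 'f, 'p) fm \<Rightarrow> 'c + nat \<times> ('c, 'f, 'p) fm"
    where "w \<phi> = Inr (Suc (level \<phi>), code \<phi>)" for \<phi>
  let ?S = "?\<iota> ` insert (Neg A) \<Gamma>"
  let ?h = "\<lambda>\<phi>. henkin_axiom \<phi> (Const (w \<phi>))"
  have w: "w \<phi> \<in> Consts ?L" if "\<phi> \<in> formulas ?L" for \<phi>
    using that code(2) by (auto simp: w_def)
  have "consistent ?L (?S \<union> ?h ` formulas ?L)"
  proof (rule henkin_axioms_consistent[where lev = level])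
    show "consistent ?L ?S"
      by (rule consistent_ext[OF assms(1,2) np])
    show "inj_on w (formulas ?L)"
      using code(1) by (auto simp: inj_on_def w_def)
    show "w \<phi> \<notin> fm_consts G" if "G \<in> ?S" for \<phi> G
    proof
      assume "w \<phi> \<in> fm_consts G"
      moreover obtain G' where "G = ?\<iota> G'" using \<open>G \<in> ?S\<close> by blast
      ultimately have "w \<phi> \<in> range Inl" using Const_terms_map by blast
      then show False by (auto simp: w_def)
    qed
    show "w \<phi> \<notin> fm_consts \<psi>" if "level \<psi> \<le> level \<phi>" for \<phi> \<psi>
      using const_level_le[of "w \<phi>" \<psi>] that by (auto simp: w_def)
  qed (rule w)
  then obtain H where H: "?S \<union> ?h ` formulas ?L \<subseteq> H" "prime_theory ?L H"
    by (rule lindenbaum)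
  \<comment> \<open>A term reaches \<open>'u\<close> in three steps: as the formula
    \<open>Exist t\<close>, then by its code as an \<open>L\<close>-formula, then by the assumed
    injection \<open>e\<close>.\<close>
  have "inj_on (\<lambda>t. e (code (Exist t))) {t. wf_tm ?L t}"
  proof (rule inj_onI)
    fix t u assume wf: "t \<in> {t. wf_tm ?L t}" "u \<in> {t. wf_tm ?L t}"
      and eq: "e (code (Exist t)) = e (code (Exist u))"
    have "Exist t \<in> formulas ?L" "Exist u \<in> formulas ?L"
      using wf by (simp_all add: formulas_def)
    then show "t = u"
      using inj_onD[OF e eq] inj_onD[OF code(1), of "Exist t" "Exist u"] code(2) by blast
  qed
  moreover have "\<exists>c\<in>Consts ?L. henkin_axiom \<phi> (Const c) \<in> H" if "wf_fm ?L \<phi>" for \<phi>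
  proof (rule bexI)
    have \<phi>: "\<phi> \<in> formulas ?L" using that by (simp add: formulas_def)
    show "w \<phi> \<in> Consts ?L" by (rule w[OF \<phi>])
    show "?h \<phi> \<in> H" using H(1) \<phi> by blast
  qed
  ultimately interpret henkin_theory ?L H "\<lambda>t. e (code (Exist t))"
    using H(2) by unfold_locales
  \<comment> \<open>On embedded formulas the reduct agrees with the term model, so the truth lemma
    comes down to \<open>L\<close>.\<close>
  have truth': "sat (reduct model) assign B \<longleftrightarrow> ?\<iota> B \<in> H" if "wf_fm L B" for B
    unfolding sat_reduct[symmetric] by (rule truth[OF wf_map_fm[OF that]])
  have S: "?\<iota> B \<in> H" if "B \<in> insert (Neg A) \<Gamma>" for B
    using H(1) that by blast
  have "is_struct L (reduct model)"
    by (rule is_struct_reduct[OF model_is_struct])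
  moreover have "range assign \<subseteq> dom (reduct model)"
    by auto
  moreover have "\<forall>G\<in>\<Gamma>. sat (reduct model) assign G"
    using assms(1) S truth' by (auto simp: formulas_def)
  ultimately have "sat (reduct model) assign A"
    using assms(4) unfolding entails_def by blast
  moreover have "sat (reduct model) assign (Neg A)"
    using assms(2) S[of "Neg A"] truth'[of "Neg A"] by (simp add: formulas_def)
  ultimately show False by simp
qed

end
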